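(* Let $a\neq 0$ be a real number and consider the quadratic polynomial vector field $\dot x=y$, $\dot y=2axy$. The following statements hold. (1) The first integral of the polynomial vector field is $I=I(x,y)=y-ax^{2}$. (2) The integral curve of the polynomial vector field is $(x(t),\dot x(t))$, where $$x(t)=\sqrt{\frac{k_1}{a}}\,\tan\left(\sqrt{k_1 a}\,(k_2+t)\right).$$ (3) The differential Galois group associated to the foliation is isomorphic to the identity group. (4) The connected identity component of the differential Galois group of the first variational equation around any particular solution is an abelian group.
   Context: In (2), $k_1,k_2$ are the constants of integration ($\dot x=ax^2+k_1$ and $\int dx/(ax^2+k_1)=t+k_2$). A first integral is a function $I$ with $\dot I=0$ along solutions. The foliation associated to a vector field $\dot x=P$, $\dot y=Q$ is the equation $y'=Q/P$, $'=d/dx$; here $y'=2ax$, considered over the differential field $\mathbb{C}(x)$. For a differential field $K$ and a Picard–Vessiot extension $L/K$ (the extension of $K$ by the solutions, having the same field of constants as $K$), the differential Galois group $DGal(L/K)$ is the group of automorphisms of $L$ that commute with the derivation and fix every element of $K$. For a particular solution $(x_0(t),y_0(t))$ with $y_0=\dot x_0$, the first variational equation is the linear system $\dot\xi=DX(x_0(t),y_0(t))\,\xi$, where $DX$ is the Jacobian matrix of the vector field.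
   Formalization: In (2) the two square roots are chosen with product k1 (principal roots give the wrong sign if a<0), and that every integral curve has this form is claimed only for k1≠0 and non-equilibrium solutions; others, e.g. x=-1/(a(t+c)), do not have this form. *)

theory Defs
  imports
    "HOL-Complex_Analysis.Complex_Analysis"
    "HOL-Computational_Algebra.Computational_Algebra"
    "HOL-Algebra.Bij"
    "HOL-Algebra.Elementary_Groups"
begin

unbundle no fps_syntax

section \<open>Planar vector fields, integral curves, first integrals\<close>

text \<open>The scalar type is either \<open>real\<close> or \<open>complex\<close>, and time has the same type as the
  coordinates.\<close>

type_synonym 'f planar_field = "'f \<times> 'f \<Rightarrow> 'f \<times> 'f"

definition quad_field :: "'f::real_normed_field \<Rightarrow> 'f planar_field" where
  "quad_field a = (\<lambda>(x, y). (y, 2 * a * x * y))"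

definition integral_curve ::
    "'f::real_normed_field planar_field \<Rightarrow> 'f set \<Rightarrow> ('f \<Rightarrow> 'f \<times> 'f) \<Rightarrow> bool" where
  "integral_curve V T \<gamma> \<longleftrightarrow> open T \<and>
     (\<forall>t\<in>T. ((\<lambda>u. fst (\<gamma> u)) has_field_derivative fst (V (\<gamma> t))) (at t) \<and>
            ((\<lambda>u. snd (\<gamma> u)) has_field_derivative snd (V (\<gamma> t))) (at t))"

definition first_integral ::
    "'f::real_normed_field planar_field \<Rightarrow> ('f \<times> 'f \<Rightarrow> 'f) \<Rightarrow> bool" where
  "first_integral V I \<longleftrightarrow>
     (\<forall>T \<gamma>. integral_curve V T \<gamma> \<longrightarrow>
        (\<forall>t\<in>T. ((\<lambda>u. I (\<gamma> u)) has_field_derivative 0) (at t)))"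

definition jacobian :: "'f::real_normed_field planar_field \<Rightarrow> 'f \<times> 'f \<Rightarrow> 'f^2^2" where
  "jacobian V p = vector
     [vector [deriv (\<lambda>x. fst (V (x, snd p))) (fst p), deriv (\<lambda>y. fst (V (fst p, y))) (snd p)],
      vector [deriv (\<lambda>x. snd (V (x, snd p))) (fst p), deriv (\<lambda>y. snd (V (fst p, y))) (snd p)]]"

text \<open>The foliation \<open>y' = Q/P\<close> of \<open>(P, Q)\<close> when, as for \<open>quad_field\<close>, the quotient \<open>Q/P\<close> reduces
  to a polynomial \<open>b\<close> in \<open>x\<close> alone.\<close>

definition foliation_slope :: "complex planar_field \<Rightarrow> complex poly \<Rightarrow> bool" where
  "foliation_slope V b \<longleftrightarrow>
     (\<forall>x y. fst (V (x, y)) \<noteq> 0 \<longrightarrow> snd (V (x, y)) / fst (V (x, y)) = poly b x)"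


section \<open>The solution formula\<close>

text \<open>\<open>compatible_roots a k r s\<close>: \<open>r\<close> and \<open>s\<close> are square roots of \<open>k/a\<close> and \<open>k a\<close> whose
  product is \<open>k\<close>. Without the last condition the pair is only determined up to independent
  signs, and \<open>r tan (s (c + t))\<close> with the wrong relative sign does not solve \<open>x' = a x\<^sup>2 + k\<close>.
  For \<open>a > 0\<close> the two principal roots are compatible; for \<open>a < 0\<close> and \<open>k \<noteq> 0\<close> they are not.\<close>

definition compatible_roots :: "real \<Rightarrow> complex \<Rightarrow> complex \<Rightarrow> complex \<Rightarrow> bool" where
  "compatible_roots a k r s \<longleftrightarrow> r\<^sup>2 = k / of_real a \<and> s\<^sup>2 = k * of_real a \<and> r * s = k"

lemma compatible_roots_exists:
  assumes "a \<noteq> 0"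
  shows "compatible_roots a k (csqrt (k / of_real a)) (of_real a * csqrt (k / of_real a))"
  using assms by (simp add: compatible_roots_def power_mult_distrib power2_eq_square[symmetric]
      mult.left_commute[of "csqrt _"]) (simp add: power2_eq_square)

lemma compatible_roots_principal:
  assumes "a > 0"
  shows "compatible_roots a k (csqrt (k / of_real a)) (csqrt (k * of_real a))"
proof -
  let ?r = "csqrt (k / of_real a)"
  have "csqrt (k * of_real a) = of_real a * ?r"
  proof (rule csqrt_unique)
    show "(of_real a * ?r)\<^sup>2 = k * of_real a"
      using assms by (simp add: power_mult_distrib) (simp add: power2_eq_square)
    show "0 < Re (of_real a * ?r) \<or> Re (of_real a * ?r) = 0 \<and> 0 \<le> Im (of_real a * ?r)"
      using assms csqrt_principal[of "k / of_real a"] by (auto simp del: csqrt.sel)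
  qed
  with compatible_roots_exists[of a k] assms show ?thesis by simp
qed

definition tan_solution :: "complex \<Rightarrow> complex \<Rightarrow> complex \<Rightarrow> complex \<Rightarrow> complex" where
  "tan_solution r s k\<^sub>2 t = r * tan (s * (k\<^sub>2 + t))"

definition tan_curve :: "complex \<Rightarrow> complex \<Rightarrow> complex \<Rightarrow> complex \<Rightarrow> complex \<times> complex" where
  "tan_curve r s k\<^sub>2 t = (tan_solution r s k\<^sub>2 t, deriv (tan_solution r s k\<^sub>2) t)"


section \<open>Differential fields\<close>

text \<open>All fields of an extension are subsets of one ambient field, given by a type, which carries
  the derivation \<open>\<delta>\<close>.\<close>

definition derivation :: "('a::field \<Rightarrow> 'a) \<Rightarrow> bool" where
  "derivation \<delta> \<longleftrightarrow> (\<forall>x y. \<delta> (x + y) = \<delta> x + \<delta> y) \<and> (\<forall>x y. \<delta> (x * y) = \<delta> x * y + x * \<delta> y)"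

definition diff_subfield :: "('a::field \<Rightarrow> 'a) \<Rightarrow> 'a set \<Rightarrow> bool" where
  "diff_subfield \<delta> K \<longleftrightarrow> 1 \<in> K \<and>
     (\<forall>x\<in>K. \<forall>y\<in>K. x - y \<in> K \<and> x * y \<in> K) \<and> (\<forall>x\<in>K. inverse x \<in> K \<and> \<delta> x \<in> K)"

definition diff_generated :: "('a::field \<Rightarrow> 'a) \<Rightarrow> 'a set \<Rightarrow> 'a set" where
  "diff_generated \<delta> S = \<Inter> {F. diff_subfield \<delta> F \<and> S \<subseteq> F}"

definition constants :: "('a::field \<Rightarrow> 'a) \<Rightarrow> 'a set \<Rightarrow> 'a set" where
  "constants \<delta> K = {c \<in> K. \<delta> c = 0}"

definition diff_hom :: "('a::field \<Rightarrow> 'a) \<Rightarrow> 'a set \<Rightarrow> ('b::field \<Rightarrow> 'b) \<Rightarrow> ('a \<Rightarrow> 'b) \<Rightarrow> bool" where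
  "diff_hom d K \<delta> \<iota> \<longleftrightarrow> \<iota> 1 = 1 \<and>
     (\<forall>x\<in>K. \<forall>y\<in>K. \<iota> (x + y) = \<iota> x + \<iota> y \<and> \<iota> (x * y) = \<iota> x * \<iota> y) \<and>
     (\<forall>x\<in>K. \<iota> (d x) = \<delta> (\<iota> x))"

text \<open>\<open>d/dx\<close> on the field \<open>\<complex>(x)\<close>, modelled as \<open>complex poly fract\<close>.\<close>

definition rat_deriv :: "complex poly fract \<Rightarrow> complex poly fract" where
  "rat_deriv f = (THE g. \<exists>p q. q \<noteq> 0 \<and> f = Fraction_Field.Fract p q \<and>
     g = Fraction_Field.Fract (pderiv p * q - p * pderiv q) (q * q))"

lemma rat_deriv_well_defined:
  fixes p q u v :: "complex poly"
  assumes q: "q \<noteq> 0" and v: "v \<noteq> 0"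
    and "Fraction_Field.Fract p q = Fraction_Field.Fract u v"
  shows "Fraction_Field.Fract (pderiv p * q - p * pderiv q) (q * q)
    = Fraction_Field.Fract (pderiv u * v - u * pderiv v) (v * v)"
proof -
  have eq: "p * v = u * q" using assms by (simp add: eq_fract)
  have "pderiv (p * v) = pderiv (u * q)" using eq by simp
  then have d: "p * pderiv v + v * pderiv p = u * pderiv q + q * pderiv u"
    by (simp add: pderiv_mult)
  then have d': "v * pderiv p = u * pderiv q + q * pderiv u - p * pderiv v"
    by (simp add: algebra_simps)
  have "(pderiv p * q - p * pderiv q) * (v * v)
      = (v * pderiv p) * (q * v) - (p * v) * (pderiv q * v)" by (simp add: algebra_simps)
  also have "\<dots> = (u * pderiv q + q * pderiv u - p * pderiv v) * (q * v) - (u * q) * (pderiv q * v)"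
    unfolding d' eq ..
  also have "\<dots> = (q * pderiv u) * (q * v) - (p * v) * (q * pderiv v)"
    by (simp add: algebra_simps)
  also have "\<dots> = (pderiv u * v - u * pderiv v) * (q * q)"
    unfolding eq by (simp add: algebra_simps)
  finally show ?thesis using q v by (simp add: eq_fract)
qed

lemma rat_deriv_Fract:
  "v \<noteq> 0 \<Longrightarrow> rat_deriv (Fraction_Field.Fract u v)
     = Fraction_Field.Fract (pderiv u * v - u * pderiv v) (v * v)"
  unfolding rat_deriv_def
  by (rule the_equality) (blast, metis rat_deriv_well_defined)

lemma derivation_rat_deriv: "derivation rat_deriv"
  unfolding derivation_def
proof (intro conjI allI)
  fix x y :: "complex poly fract"
  obtain p q where x: "x = Fraction_Field.Fract p q" "q \<noteq> 0" by (cases x)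
  obtain u v where y: "y = Fraction_Field.Fract u v" "v \<noteq> 0" by (cases y)
  have "rat_deriv (x + y) = Fraction_Field.Fract
      (pderiv (p * v + u * q) * (q * v) - (p * v + u * q) * pderiv (q * v)) ((q * v) * (q * v))"
    using x y by (simp add: rat_deriv_Fract)
  also have "\<dots> = rat_deriv x + rat_deriv y"
    using x y by (simp add: rat_deriv_Fract eq_fract pderiv_mult pderiv_add) (simp add: algebra_simps)
  finally show "rat_deriv (x + y) = rat_deriv x + rat_deriv y" .
  have "rat_deriv (x * y) = Fraction_Field.Fract
      (pderiv (p * u) * (q * v) - (p * u) * pderiv (q * v)) ((q * v) * (q * v))"
    using x y by (simp add: rat_deriv_Fract)
  also have "\<dots> = rat_deriv x * y + x * rat_deriv y"
    using x y by (simp add: rat_deriv_Fract eq_fract pderiv_mult) (simp add: algebra_simps)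
  finally show "rat_deriv (x * y) = rat_deriv x * y + x * rat_deriv y" .
qed

text \<open>Germs at \<open>t\<^sub>0\<close> of holomorphic functions, as elements of the differential field of formal
  Laurent series in \<open>t - t\<^sub>0\<close> with derivation \<open>fls_deriv\<close>.\<close>

definition germ :: "complex \<Rightarrow> (complex \<Rightarrow> complex) \<Rightarrow> complex fls" where
  "germ t\<^sub>0 f = fps_to_fls (fps_expansion f t\<^sub>0)"

lemma derivation_fls_deriv: "derivation (fls_deriv :: complex fls \<Rightarrow> complex fls)"
  unfolding derivation_def by (simp add: algebra_simps)


section \<open>Picard--Vessiot extensions\<close>

definition linear_solutions ::
    "('a::field \<Rightarrow> 'a) \<Rightarrow> 'a set \<Rightarrow> 'a^'n^'n \<Rightarrow> 'a^'n \<Rightarrow> ('a^'n) set" where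
  "linear_solutions \<delta> L A b = {\<xi>. (\<forall>i. \<xi> $ i \<in> L) \<and> (\<chi> i. \<delta> (\<xi> $ i)) = A *v \<xi> + b}"

definition fundamental_matrix ::
    "('a::field \<Rightarrow> 'a) \<Rightarrow> 'a set \<Rightarrow> 'a^'n^'n \<Rightarrow> 'a^'n^'n \<Rightarrow> bool" where
  "fundamental_matrix \<delta> L A F \<longleftrightarrow>
     (\<forall>i j. F $ i $ j \<in> L) \<and> invertible F \<and> (\<chi> i j. \<delta> (F $ i $ j)) = A ** F"

text \<open>\<open>L\<close> is a Picard--Vessiot extension of \<open>K\<close> for the linear system \<open>\<xi>' = A \<xi> + b\<close>: it contains
  a full set of solutions, is generated over \<open>K\<close> by the solutions, and has no new constants.
  For \<open>b = 0\<close> the solutions are the constant linear combinations of the columns of any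
  fundamental matrix, so this is the usual definition; \<open>b \<noteq> 0\<close> is needed for the foliation, which
  is an inhomogeneous equation.\<close>

definition picard_vessiot ::
    "('a::field \<Rightarrow> 'a) \<Rightarrow> 'a set \<Rightarrow> 'a set \<Rightarrow> 'a^'n^'n \<Rightarrow> 'a^'n \<Rightarrow> bool" where
  "picard_vessiot \<delta> K L A b \<longleftrightarrow>
     derivation \<delta> \<and> diff_subfield \<delta> K \<and> diff_subfield \<delta> L \<and> K \<subseteq> L \<and>
     (\<forall>i j. A $ i $ j \<in> K) \<and> (\<forall>i. b $ i \<in> K) \<and>
     (\<exists>F. fundamental_matrix \<delta> L A F) \<and>
     linear_solutions \<delta> L A b \<noteq> {} \<and>
     L = diff_generated \<delta> (K \<union> {\<xi> $ i | \<xi> i. \<xi> \<in> linear_solutions \<delta> L A b}) \<and>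
     constants \<delta> L = constants \<delta> K"


section \<open>Differential Galois groups\<close>

definition DGal :: "('a::field \<Rightarrow> 'a) \<Rightarrow> 'a set \<Rightarrow> 'a set \<Rightarrow> ('a \<Rightarrow> 'a) monoid" where
  "DGal \<delta> K L = (BijGroup L)\<lparr>carrier := {\<sigma> \<in> Bij L.
     (\<forall>x\<in>L. \<forall>y\<in>L. \<sigma> (x + y) = \<sigma> x + \<sigma> y \<and> \<sigma> (x * y) = \<sigma> x * \<sigma> y) \<and>
     (\<forall>x\<in>L. \<sigma> (\<delta> x) = \<delta> (\<sigma> x)) \<and>
     (\<forall>x\<in>K. \<sigma> x = x)}\<rparr>"

text \<open>The matrix \<open>M\<^sub>\<sigma>\<close> with \<open>\<sigma> F = F M\<^sub>\<sigma>\<close>. It has constant entries, and \<open>\<sigma> \<mapsto> M\<^sub>\<sigma>\<close> is the usual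
  faithful representation of the Galois group of a homogeneous system as a linear algebraic
  group over the constants.\<close>

definition galois_matrix :: "'a::field^'n^'n \<Rightarrow> ('a \<Rightarrow> 'a) \<Rightarrow> 'a^'n^'n" where
  "galois_matrix F \<sigma> = matrix_inv F ** (\<chi> i j. \<sigma> (F $ i $ j))"

text \<open>Polynomial functions of the matrix entries with coefficients in \<open>C\<close>.\<close>

inductive matrix_polynomial :: "'a::field set \<Rightarrow> ('a^'n^'n \<Rightarrow> 'a) \<Rightarrow> bool" for C where
  const: "c \<in> C \<Longrightarrow> matrix_polynomial C (\<lambda>M. c)"
| entry: "matrix_polynomial C (\<lambda>M. M $ i $ j)"
| add: "matrix_polynomial C p \<Longrightarrow> matrix_polynomial C q \<Longrightarrow> matrix_polynomial C (\<lambda>M. p M + q M)"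
| mult: "matrix_polynomial C p \<Longrightarrow> matrix_polynomial C q \<Longrightarrow> matrix_polynomial C (\<lambda>M. p M * q M)"

definition zariski :: "'a::field set \<Rightarrow> ('a^'n^'n) topology" where
  "zariski C = topology_generated_by {{M. p M \<noteq> 0} | p. matrix_polynomial C p}"

definition DGal_topology ::
    "('a::field \<Rightarrow> 'a) \<Rightarrow> 'a set \<Rightarrow> 'a set \<Rightarrow> 'a^'n^'n \<Rightarrow> ('a \<Rightarrow> 'a) topology" where
  "DGal_topology \<delta> K L F =
     pullback_topology (carrier (DGal \<delta> K L)) (galois_matrix F) (zariski (constants \<delta> K))"

text \<open>The Zariski-connected component of the identity, as a group. The topology does not depend on
  the choice of the fundamental matrix \<open>F\<close>.\<close>

definition DGal_identity_component ::
    "('a::field \<Rightarrow> 'a) \<Rightarrow> 'a set \<Rightarrow> 'a set \<Rightarrow> 'a^'n^'n \<Rightarrow> ('a \<Rightarrow> 'a) monoid" where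
  "DGal_identity_component \<delta> K L F = (DGal \<delta> K L)\<lparr>carrier :=
     connected_component_of_set (DGal_topology \<delta> K L F) (one (DGal \<delta> K L))\<rparr>"


section \<open>The first variational equation\<close>

text \<open>Coefficient matrix of \<open>\<xi>' = DV(\<gamma>(t)) \<xi>\<close>, its entries taken as germs at \<open>t\<^sub>0\<close>.\<close>

definition variational_matrix ::
    "complex planar_field \<Rightarrow> (complex \<Rightarrow> complex \<times> complex) \<Rightarrow> complex \<Rightarrow> complex fls^2^2" where
  "variational_matrix V \<gamma> t\<^sub>0 = (\<chi> i j. germ t\<^sub>0 (\<lambda>t. jacobian V (\<gamma> t) $ i $ j))"

text \<open>Differential fields of germs over which the variational equation along \<open>\<gamma>\<close> is considered:
  they contain \<open>\<complex>\<close> and both coordinates of \<open>\<gamma>\<close>. The smallest is \<open>\<complex>(x\<^sub>0, y\<^sub>0)\<close>.\<close>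

definition coefficient_field ::
    "(complex \<Rightarrow> complex \<times> complex) \<Rightarrow> complex \<Rightarrow> complex fls set \<Rightarrow> bool" where
  "coefficient_field \<gamma> t\<^sub>0 K \<longleftrightarrow> diff_subfield fls_deriv K \<and> range fls_const \<subseteq> K \<and>
     germ t\<^sub>0 (\<lambda>t. fst (\<gamma> t)) \<in> K \<and> germ t\<^sub>0 (\<lambda>t. snd (\<gamma> t)) \<in> K"

end

(* With k = y - a x^2 constant along a curve and r s = k, s = a r, the function
   p = r sin(theta) - x cos(theta), theta = s (c + t), satisfies p' = a x p; choosing c such that p
   vanishes at one time makes it vanish throughout, hence x = r tan(theta).

   The foliation y' = 2 a x is solved by the rational functions a x^2 + const, so its Picard-Vessiot
   extension is trivial.

   For a solution (xi1, xi2) of the variational equation, w = xi2 - 2 a x xi1 is a constant. The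
   remaining equation xi1' = 2 a x xi1 + w has y as a solution of its homogeneous part, so if y is not
   zero automorphisms only translate xi1 by elements of the base field; if y = 0 then x is constant,
   and automorphisms translate xi1 (x = 0) or rescale it up to a shift (x not 0). In all cases the
   whole Galois group is abelian. Its identity component is a subgroup because left translations are
   Zariski continuous. *)
theory Submission
  imports Defs
begin

section \<open>Tangent solutions of the Riccati equation, and the first integral\<close>

section \<open>Integral curves\<close>

text \<open>A Gronwall argument by the mean value inequality: on a small enough ball that contains a
  zero, the maximum of \<open>norm (f t)\<close> is at most half of itself. So vanishing spreads
  over the ball, and connectedness carries it across \<open>T\<close>.\<close>

lemma zero_of_derivative_bound:
  fixes f :: "'a::{real_normed_vector,heine_borel} \<Rightarrow> 'b::real_normed_vector"
  assumes T: "open T" "connected T" and B: "continuous_on T B"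
    and D: "\<And>t. t \<in> T \<Longrightarrow> (f has_derivative D t) (at t)"
    and le: "\<And>t h. t \<in> T \<Longrightarrow> norm (D t h) \<le> B t * norm (f t) * norm h"
    and u: "u \<in> T" "f u = 0" and v: "v \<in> T"
  shows "f v = 0"
proof (rule connected_induction_simple[OF T(2) u(1) v, where P = "\<lambda>t. f t = 0"])
  show "f u = 0" by fact
  fix c assume c: "c \<in> T"
  obtain e where e: "e > 0" "cball c e \<subseteq> T" using T(1) c open_contains_cball by blast
  have "compact (B ` cball c e)"
    using B e by (meson compact_cball compact_continuous_image continuous_on_subset)
  then obtain M where M: "M > 0" "\<And>t. t \<in> cball c e \<Longrightarrow> norm (B t) \<le> M"
    using compact_imp_bounded bounded_pos by (metis imageI)
  \<comment> \<open>The bound \<open>M\<close> times the diameter \<open>2 * d\<close> is then at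
    most \<open>1 / 2\<close>, which makes the estimate at the maximum point \<open>z\<close>
    contract.\<close>
  define d where "d = min e (1 / (4 * M))"
  have d: "d > 0" "d \<le> e" "4 * M * d \<le> 1"
    using e M by (auto simp: d_def min_def field_simps)
  have sub: "cball c d \<subseteq> cball c e" "cball c d \<subseteq> T" using d e by auto
  have cont: "continuous_on (cball c d) (\<lambda>t. norm (f t))"
  proof (intro continuous_on_norm continuous_at_imp_continuous_on ballI)
    fix t assume "t \<in> cball c d"
    then have "t \<in> T" using sub by auto
    then show "isCont f t" by (rule has_derivative_continuous[OF D])
  qed
  obtain z where z: "z \<in> cball c d" "\<And>t. t \<in> cball c d \<Longrightarrow> norm (f t) \<le> norm (f z)"
    using continuous_attains_sup[OF compact_cball _ cont] d by (metis cball_eq_empty not_less order_less_imp_le)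
  have "f y = 0" if x: "x \<in> cball c d" "f x = 0" and y: "y \<in> cball c d" for x y
  proof -
    have "norm (f z - f x) \<le> (M * norm (f z)) * norm (z - x)"
    proof (rule differentiable_bound[OF convex_cball _ _ z(1) x(1)])
      fix t assume t: "t \<in> cball c d"
      show "(f has_derivative D t) (at t within cball c d)"
        using D t sub has_derivative_at_withinI by blast
      show "onorm (D t) \<le> M * norm (f z)"
      proof (rule onorm_bound)
        have tT: "t \<in> T" using t sub by auto
        show "0 \<le> M * norm (f z)" using M by simp
        fix h
        have "B t \<le> M" using M(2)[of t] t sub by auto
        then have "B t * norm (f t) \<le> M * norm (f z)"
          using z(2)[OF t] M(1) by (meson mult_mono norm_ge_zero less_imp_le)
        then show "norm (D t h) \<le> M * norm (f z) * norm h"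
          using le[OF tT, of h] by (meson mult_right_mono norm_ge_zero order_trans)
      qed
    qed
    also have "\<dots> \<le> (M * norm (f z)) * (2 * d)"
    proof (rule mult_left_mono)
      have "norm (z - x) \<le> dist c z + dist c x"
        by (metis dist_norm dist_triangle3 add.commute dist_commute)
      then show "norm (z - x) \<le> 2 * d" using z(1) x(1) by auto
    qed (use M in simp)
    also have "\<dots> = (4 * M * d) * (norm (f z) / 2)" by simp
    also have "\<dots> \<le> norm (f z) / 2" using mult_right_mono[OF d(3), of "norm (f z) / 2"] by simp
    finally have "norm (f z) = 0" using x by simp
    then show ?thesis using z(2)[OF y] by simp
  qed
  then show "\<exists>U. openin (top_of_set T) U \<and> c \<in> U \<and> (\<forall>x\<in>U. \<forall>y\<in>U. f x = 0 \<longrightarrow> f y = 0)"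
  proof (intro exI[of _ "ball c d"] conjI ballI impI)
    have "ball c d \<subseteq> T" using sub(2) ball_subset_cball by blast
    then show "openin (top_of_set T) (ball c d)" using T(1) by (simp add: openin_open_eq)
    show "c \<in> ball c d" using d by simp
  qed (meson ball_subset_cball subsetD)
qed

text \<open>A zero of \<open>cos\<close> would also be a zero of \<open>sin\<close>, against the
  Pythagorean identity. So this relation keeps a solution away from the poles of
  \<open>tan\<close>.\<close>

lemma eq_tan_if_sin_cos:
  fixes r x w :: complex
  assumes "r * sin w = x * cos w" "r \<noteq> 0"
  shows "cos w \<noteq> 0 \<and> x = r * tan w"
proof -
  have "cos w \<noteq> 0"
  proof
    assume c: "cos w = 0"
    then have "sin w = 0" using assms by simp
    with c show False using sin_cos_squared_add[of w] by simp
  qed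
  then show ?thesis using assms by (simp add: tan_def field_simps)
qed

text \<open>The derivative is \<open>r * s\<close> times one plus the squared tangent. Since
  \<open>r * s = k\<close>, this is \<open>k\<close> plus \<open>k\<close> times the squared
  tangent, and the latter is the quadratic term because \<open>a\<close> times the square of
  \<open>r\<close> is also \<open>k\<close>.\<close>

lemma tan_solution_derivative:
  assumes "compatible_roots a k r s" "a \<noteq> 0" "cos (s * (c + t)) \<noteq> 0"
  shows "(tan_solution r s c has_field_derivative of_real a * (tan_solution r s c t)\<^sup>2 + k) (at t)"
proof -
  have "(tan_solution r s c has_field_derivative r * (inverse ((cos (s * (c + t)))\<^sup>2) * s)) (at t)"
    unfolding tan_solution_def[abs_def] using assms(3)
    by (auto intro!: derivative_eq_intros)
  moreover have "r * (inverse ((cos (s * (c + t)))\<^sup>2) * s) = of_real a * (tan_solution r s c t)\<^sup>2 + k"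
  proof -
    have "of_real a * (tan_solution r s c t)\<^sup>2 = k * (tan (s * (c + t)))\<^sup>2"
      using assms by (simp add: compatible_roots_def tan_solution_def power_mult_distrib)
    moreover have "inverse ((cos (s * (c + t)))\<^sup>2) = (tan (s * (c + t)))\<^sup>2 + 1"
      using tan_sec[OF assms(3)] by (simp add: power_inverse add.commute)
    moreover have "r * s = k" using assms by (simp add: compatible_roots_def)
    ultimately show ?thesis by (simp add: algebra_simps)
  qed
  ultimately show ?thesis by simp
qed

lemma integral_curve_tan_curve:
  assumes "compatible_roots a k r s" "a \<noteq> 0"
  shows "integral_curve (quad_field (complex_of_real a)) {t. cos (s * (c + t)) \<noteq> 0} (tan_curve r s c)"
proof -
  let ?T = "{t. cos (s * (c + t)) \<noteq> 0}" and ?x = "tan_solution r s c"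
  have op: "open ?T" by (intro open_Collect_neq continuous_intros)
  have d: "(?x has_field_derivative of_real a * (?x t)\<^sup>2 + k) (at t)" if "t \<in> ?T" for t
    using tan_solution_derivative[OF assms] that by simp
  have eq: "deriv ?x t = of_real a * (?x t)\<^sup>2 + k" if "t \<in> ?T" for t
    using d[OF that] by (rule DERIV_imp_deriv)
  \<comment> \<open>The second component of the field is the derivative of the Riccati right-hand
    side, which equals \<open>deriv ?x\<close> on the whole open set \<open>?T\<close>.\<close>
  have dd: "(deriv ?x has_field_derivative 2 * of_real a * ?x t * deriv ?x t) (at t)" if t: "t \<in> ?T" for t
  proof -
    have "((\<lambda>t. of_real a * (?x t)\<^sup>2 + k) has_field_derivative 2 * of_real a * ?x t * deriv ?x t) (at t)"
      unfolding eq[OF t] using d[OF t] by (auto intro!: derivative_eq_intros)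
    then show ?thesis
      by (rule has_field_derivative_transform_within_open[OF _ op t]) (simp add: eq)
  qed
  show ?thesis
    unfolding integral_curve_def quad_field_def tan_curve_def
    using op dd d eq by auto
qed

text \<open>The embedding \<open>j\<close> of the time line covers real and complex time at once. The function
  \<open>r sin \<theta> - x cos \<theta>\<close> with \<open>\<theta> = s (c + t)\<close> satisfies \<open>p' = a x p\<close>, so it vanishes identically
  once it vanishes at one point.\<close>

lemma integral_curve_eq_tan:
  fixes j :: "'a::{real_normed_vector,heine_borel} \<Rightarrow> complex"
  assumes T: "open T" "connected T" and j: "bounded_linear j" and u: "u \<in> T"
    and X: "\<And>t. t \<in> T \<Longrightarrow> (x has_derivative (\<lambda>h. j h * y t)) (at t)"
    and Y: "\<And>t. t \<in> T \<Longrightarrow> (y has_derivative (\<lambda>h. j h * (2 * of_real a * x t * y t))) (at t)"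
    and y: "y u \<noteq> 0" and k: "k = y u - of_real a * (x u)\<^sup>2" "k \<noteq> 0"
    and rs: "compatible_roots a k r s" and a: "a \<noteq> 0"
  shows "\<exists>c. \<forall>t\<in>T. cos (s * (c + j t)) \<noteq> 0 \<and> (x t, y t) = tan_curve r s c (j t)"
proof -
  have rs': "r\<^sup>2 = k / of_real a" "r * s = k" "r \<noteq> 0" "s \<noteq> 0"
    using rs k by (auto simp: compatible_roots_def)
  have s: "s = of_real a * r"
  proof -
    have "r * s = r * (of_real a * r)" using rs' a by (simp add: power2_eq_square field_simps)
    then show ?thesis using rs' by simp
  qed
  have y_eq: "y t = of_real a * (x t)\<^sup>2 + k" if t: "t \<in> T" for t
  proof -
    have "y t - of_real a * (x t)\<^sup>2 = y u - of_real a * (x u)\<^sup>2"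
    proof (rule has_derivative_zero_unique_connected[OF T _ t u])
      fix t assume t: "t \<in> T"
      show "((\<lambda>t. y t - of_real a * (x t)\<^sup>2) has_derivative (\<lambda>h. 0)) (at t)"
        by (rule derivative_eq_intros X[OF t] Y[OF t] refl)+ (simp add: algebra_simps)
    qed
    also have "\<dots> = k" using k by simp
    finally show ?thesis by (metis add.commute diff_add_cancel)
  qed
  \<comment> \<open>The values that \<open>tan\<close> omits are i and -i. Here they would make
    \<open>of_real a * (x u)\<^sup>2\<close> equal to \<open>- k\<close>, that is,
    \<open>y u = 0\<close>.\<close>
  have "(x u / r)\<^sup>2 \<noteq> -1"
  proof
    assume "(x u / r)\<^sup>2 = -1"
    moreover have "(x u)\<^sup>2 = (x u / r)\<^sup>2 * r\<^sup>2" using rs'(3) by (simp add: power_divide)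
    ultimately have "(x u)\<^sup>2 = - r\<^sup>2" by simp
    then have "y u = 0" using y_eq[OF u] rs' a by simp
    with y show False by simp
  qed
  then have tw: "tan (Arctan (x u / r)) = x u / r" by simp
  \<comment> \<open>With this shift the angle at time \<open>u\<close> is
    \<open>Arctan (x u / r)\<close>, so that \<open>p\<close> vanishes there.\<close>
  define c where "c = Arctan (x u / r) / s - j u"
  define p where "p t = r * sin (s * (c + j t)) - x t * cos (s * (c + j t))" for t
  have p_u: "p u = 0"
  proof -
    have w: "s * (c + j u) = Arctan (x u / r)" using rs' by (simp add: c_def)
    \<comment> \<open>With a zero cosine, \<open>tan\<close> would be 0 by the convention for
      division by zero. The angle would then be \<open>Arctan 0 = 0\<close>, whose cosine is
      1.\<close>
    have "cos (Arctan (x u / r)) \<noteq> 0"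
    proof
      assume "cos (Arctan (x u / r)) = 0"
      moreover from this tw have "x u / r = 0" by (simp add: tan_def)
      ultimately show False by (simp only: Arctan_0 cos_zero) simp
    qed
    then show ?thesis unfolding p_def w using tw rs' by (simp add: tan_def field_simps)
  qed
  have p_zero: "p t = 0" if "t \<in> T" for t
  proof (rule zero_of_derivative_bound[where T = T and f = p and u = u])
    show "continuous_on T (\<lambda>t. onorm j * norm (complex_of_real a * x t))"
      by (intro continuous_intros continuous_at_imp_continuous_on ballI) (rule has_derivative_continuous[OF X])
    show "u \<in> T" "p u = 0" "t \<in> T" "open T" "connected T" using T u p_u that by auto
  next
    fix t assume t: "t \<in> T"
    define S C where "S = sin (s * (c + j t))" and "C = cos (s * (c + j t))"
    have \<theta>: "((\<lambda>t. s * (c + j t)) has_derivative (\<lambda>h. s * j h)) (at t)"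
      using bounded_linear_imp_has_derivative[OF j] by (auto intro!: derivative_eq_intros)
    have "((\<lambda>t. r * sin (s * (c + j t)) - x t * cos (s * (c + j t))) has_derivative
        (\<lambda>h. r * (C * (s * j h)) - (x t * (- S * (s * j h)) + j h * y t * C))) (at t)"
      unfolding S_def C_def
      by (rule has_derivative_diff[OF has_derivative_mult_right[OF has_derivative_compose[OF \<theta> DERIV_sin[THEN has_field_derivative_imp_has_derivative]]]
            has_derivative_mult[OF X[OF t] has_derivative_compose[OF \<theta> DERIV_cos[THEN has_field_derivative_imp_has_derivative]]]])
    \<comment> \<open>The term \<open>k * z * C\<close> cancels against the \<open>k\<close> in
      \<open>y t\<close>, and \<open>s = of_real a * r\<close> supplies the common factor
      \<open>of_real a * x t\<close>.\<close>
    moreover have "r * (C * (s * z)) - (x t * (- S * (s * z)) + z * y t * C) = z * (of_real a * x t * p t)" for z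
    proof -
      have "r * (s * z * C) = k * z * C" using rs'(2) by (simp add: mult_ac)
      then show ?thesis
        unfolding y_eq[OF t] p_def s S_def[symmetric, unfolded s] C_def[symmetric, unfolded s]
        by (simp add: algebra_simps power2_eq_square)
    qed
    ultimately have "((\<lambda>t. r * sin (s * (c + j t)) - x t * cos (s * (c + j t))) has_derivative
        (\<lambda>h. j h * (of_real a * x t * p t))) (at t)"
      by simp
    then show "(p has_derivative (\<lambda>h. j h * (of_real a * x t * p t))) (at t)"
      by (simp add: p_def[abs_def])
    fix h
    show "norm (j h * (of_real a * x t * p t)) \<le> onorm j * norm (of_real a * x t) * norm (p t) * norm h"
      using mult_right_mono[OF onorm[OF j, of h], of "norm (of_real a * x t) * norm (p t)"]
      by (simp add: norm_mult mult_ac)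
  qed
  show ?thesis
  proof (intro exI ballI)
    fix t assume t: "t \<in> T"
    have "r * sin (s * (c + j t)) = x t * cos (s * (c + j t))" using p_zero[OF t] by (simp add: p_def)
    from eq_tan_if_sin_cos[OF this rs'(3)]
    have ct: "cos (s * (c + j t)) \<noteq> 0" and xt: "x t = tan_solution r s c (j t)"
      by (auto simp: tan_solution_def)
    moreover have "y t = deriv (tan_solution r s c) (j t)"
      using DERIV_imp_deriv[OF tan_solution_derivative[OF rs a ct]] y_eq[OF t] xt by simp
    ultimately show "cos (s * (c + j t)) \<noteq> 0 \<and> (x t, y t) = tan_curve r s c (j t)"
      by (simp add: tan_curve_def)
  qed
qed

text \<open>The chain rule leaves \<open>2 * a * x * y - a * (2 * x * y)\<close>. The scalar field
  is kept generic to serve both real and complex time.\<close>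

lemma first_integral_quad_field: "first_integral (quad_field a) (\<lambda>(x, y). y - a * x\<^sup>2)"
  unfolding first_integral_def integral_curve_def quad_field_def case_prod_beta
proof (intro allI impI ballI)
  fix T and \<gamma> :: "'a \<Rightarrow> 'a \<times> 'a" and t
  assume V: "open T \<and> (\<forall>t\<in>T. ((\<lambda>u. fst (\<gamma> u)) has_field_derivative fst (snd (\<gamma> t), 2 * a * fst (\<gamma> t) * snd (\<gamma> t))) (at t) \<and>
      ((\<lambda>u. snd (\<gamma> u)) has_field_derivative snd (snd (\<gamma> t), 2 * a * fst (\<gamma> t) * snd (\<gamma> t))) (at t))"
    and "t \<in> T"
  then have "((\<lambda>u. fst (\<gamma> u)) has_field_derivative snd (\<gamma> t)) (at t)"
      "((\<lambda>u. snd (\<gamma> u)) has_field_derivative 2 * a * fst (\<gamma> t) * snd (\<gamma> t)) (at t)" by auto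
  from DERIV_diff[OF this(2) DERIV_cmult[OF DERIV_power[OF this(1), of 2], of a]]
  show "((\<lambda>u. snd (\<gamma> u) - a * (fst (\<gamma> u))\<^sup>2) has_field_derivative 0) (at t)"
    by (simp add: mult_ac)
qed

lemma complex_integral_curve_eq_tan:
  assumes V: "integral_curve (quad_field (complex_of_real a)) T \<gamma>" and T: "connected T" "u \<in> T"
    "snd (\<gamma> u) \<noteq> 0" and k: "k = snd (\<gamma> u) - of_real a * (fst (\<gamma> u))\<^sup>2" "k \<noteq> 0"
    and rs: "compatible_roots a k r s" "a \<noteq> 0"
  shows "\<exists>c. \<forall>t\<in>T. cos (s * (c + t)) \<noteq> 0 \<and> \<gamma> t = tan_curve r s c t"
proof -
  have "\<exists>c. \<forall>t\<in>T. cos (s * (c + t)) \<noteq> 0 \<and> (fst (\<gamma> t), snd (\<gamma> t)) = tan_curve r s c t"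
  proof (rule integral_curve_eq_tan[OF _ T(1) bounded_linear_ident T(2) _ _ _ _ k(2) rs])
    show "open T" using V by (simp add: integral_curve_def)
    fix t assume "t \<in> T"
    then have "((\<lambda>t. fst (\<gamma> t)) has_field_derivative snd (\<gamma> t)) (at t)"
        "((\<lambda>t. snd (\<gamma> t)) has_field_derivative 2 * of_real a * fst (\<gamma> t) * snd (\<gamma> t)) (at t)"
      using V by (auto simp: integral_curve_def quad_field_def case_prod_beta)
    then show "((\<lambda>t. fst (\<gamma> t)) has_derivative (\<lambda>h. h * snd (\<gamma> t))) (at t)"
      "((\<lambda>t. snd (\<gamma> t)) has_derivative (\<lambda>h. h * (2 * of_real a * fst (\<gamma> t) * snd (\<gamma> t)))) (at t)"
      unfolding has_field_derivative_def by - (erule has_derivative_eq_rhs, simp add: fun_eq_iff)+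
  qed (use T k in auto)
  then show ?thesis by simp
qed

text \<open>The case \<open>j = of_real\<close>. Coordinates are cast to complex numbers because
  \<open>r\<close> and \<open>s\<close> are imaginary when \<open>k * a < 0\<close>.\<close>

lemma real_integral_curve_eq_tan:
  assumes V: "integral_curve (quad_field a) T \<gamma>" and T: "connected T" "u \<in> T"
    "snd (\<gamma> u) \<noteq> 0" and k: "k = snd (\<gamma> u) - a * (fst (\<gamma> u))\<^sup>2" "k \<noteq> 0"
    and rs: "compatible_roots a (of_real k) r s" "a \<noteq> 0"
  shows "\<exists>c. \<forall>t\<in>T. cos (s * (c + of_real t)) \<noteq> 0 \<and>
    (complex_of_real (fst (\<gamma> t)), complex_of_real (snd (\<gamma> t))) = tan_curve r s c (of_real t)"
proof (rule integral_curve_eq_tan[OF _ T(1) bounded_linear_of_real T(2) _ _ _ _ _ rs])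
  show "open T" using V by (simp add: integral_curve_def)
  fix t assume "t \<in> T"
  then have "((\<lambda>t. fst (\<gamma> t)) has_derivative (*) (snd (\<gamma> t))) (at t)"
      "((\<lambda>t. snd (\<gamma> t)) has_derivative (*) (2 * a * fst (\<gamma> t) * snd (\<gamma> t))) (at t)"
    using V by (auto simp: integral_curve_def quad_field_def case_prod_beta has_field_derivative_def)
  from this[THEN has_derivative_of_real[where 'a = complex]]
  show "((\<lambda>t. of_real (fst (\<gamma> t))) has_derivative (\<lambda>h. of_real h * complex_of_real (snd (\<gamma> t)))) (at t)"
    "((\<lambda>t. of_real (snd (\<gamma> t))) has_derivative
      (\<lambda>h. of_real h * (2 * complex_of_real a * of_real (fst (\<gamma> t)) * of_real (snd (\<gamma> t))))) (at t)"
    by (simp_all add: mult_ac)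
next
  have "complex_of_real (snd (\<gamma> u)) \<noteq> 0 \<and>
      complex_of_real k = of_real (snd (\<gamma> u)) - of_real a * (of_real (fst (\<gamma> u)))\<^sup>2 \<and> complex_of_real k \<noteq> 0"
    using T k(2) by (subst k(1)) (simp only: of_real_diff of_real_mult of_real_power of_real_eq_0_iff simp_thms)
  then show "complex_of_real (snd (\<gamma> u)) \<noteq> 0"
    "complex_of_real k = of_real (snd (\<gamma> u)) - of_real a * (of_real (fst (\<gamma> u)))\<^sup>2" "complex_of_real k \<noteq> 0"
    by blast+
qed

section \<open>Differential subfields, and the trivial Galois group of the foliation\<close>

section \<open>Differential fields\<close>

lemma derivation_add: "derivation \<delta> \<Longrightarrow> \<delta> (x + y) = \<delta> x + \<delta> y"
  and derivation_mult: "derivation \<delta> \<Longrightarrow> \<delta> (x * y) = \<delta> x * y + x * \<delta> y"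
  by (auto simp: derivation_def)

lemma derivation_0: "derivation \<delta> \<Longrightarrow> \<delta> 0 = 0"
  using derivation_add[of \<delta> 0 0] by (metis add.right_neutral add_left_cancel)

lemma derivation_1: "derivation \<delta> \<Longrightarrow> \<delta> 1 = 0"
  using derivation_mult[of \<delta> 1 1] by (metis add.right_neutral add_left_cancel mult_1 mult_1_right)

lemma derivation_diff: "derivation \<delta> \<Longrightarrow> \<delta> (x - y) = \<delta> x - \<delta> y"
  using derivation_add[of \<delta> "x - y" y] by simp

lemma derivation_sum: "derivation \<delta> \<Longrightarrow> \<delta> (sum f S) = (\<Sum>i\<in>S. \<delta> (f i))"
  by (induction S rule: infinite_finite_induct) (simp_all add: derivation_0 derivation_add)

text \<open>Expanding \<open>\<delta> (p / z * z)\<close> by the product rule leaves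
  \<open>\<delta> (p / z) * z = 0\<close>. This is how two solutions of one homogeneous first-order
  equation are compared below.\<close>

lemma derivation_quotient_eq_0:
  assumes "derivation \<delta>" "\<delta> p = g * p" "\<delta> z = g * z" "z \<noteq> 0"
  shows "\<delta> (p / z) = 0"
proof -
  have "g * p = \<delta> (p / z * z)" using assms by simp
  also have "\<dots> = \<delta> (p / z) * z + p / z * (g * z)" using assms derivation_mult by metis
  also have "p / z * (g * z) = g * p" using assms by simp
  finally show ?thesis using assms by simp
qed

lemma diff_subfield_1: "diff_subfield \<delta> K \<Longrightarrow> 1 \<in> K"
  and diff_subfield_diff: "diff_subfield \<delta> K \<Longrightarrow> x \<in> K \<Longrightarrow> y \<in> K \<Longrightarrow> x - y \<in> K"
  and diff_subfield_mult: "diff_subfield \<delta> K \<Longrightarrow> x \<in> K \<Longrightarrow> y \<in> K \<Longrightarrow> x * y \<in> K"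
  and diff_subfield_inverse: "diff_subfield \<delta> K \<Longrightarrow> x \<in> K \<Longrightarrow> inverse x \<in> K"
  and diff_subfield_deriv: "diff_subfield \<delta> K \<Longrightarrow> x \<in> K \<Longrightarrow> \<delta> x \<in> K"
  by (auto simp: diff_subfield_def)

lemma diff_subfield_0: "diff_subfield \<delta> K \<Longrightarrow> 0 \<in> K"
  using diff_subfield_diff[of \<delta> K 1 1] diff_subfield_1[of \<delta> K] by simp

lemma diff_subfield_uminus: "diff_subfield \<delta> K \<Longrightarrow> x \<in> K \<Longrightarrow> - x \<in> K"
  using diff_subfield_diff[of \<delta> K 0 x] diff_subfield_0[of \<delta> K] by simp

lemma diff_subfield_add: "diff_subfield \<delta> K \<Longrightarrow> x \<in> K \<Longrightarrow> y \<in> K \<Longrightarrow> x + y \<in> K"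
  using diff_subfield_diff[of \<delta> K x "- y"] diff_subfield_uminus[of \<delta> K y] by simp

lemma diff_subfield_divide: "diff_subfield \<delta> K \<Longrightarrow> x \<in> K \<Longrightarrow> y \<in> K \<Longrightarrow> x / y \<in> K"
  unfolding divide_inverse by (blast intro: diff_subfield_mult diff_subfield_inverse)

lemma diff_subfield_sum:
  "diff_subfield \<delta> K \<Longrightarrow> (\<And>i. i \<in> S \<Longrightarrow> f i \<in> K) \<Longrightarrow> sum f S \<in> K"
  by (induction S rule: infinite_finite_induct) (simp_all add: diff_subfield_0 diff_subfield_add)

lemma diff_subfield_prod:
  "diff_subfield \<delta> K \<Longrightarrow> (\<And>i. i \<in> S \<Longrightarrow> f i \<in> K) \<Longrightarrow> prod f S \<in> K"
  by (induction S rule: infinite_finite_induct) (simp_all add: diff_subfield_1 diff_subfield_mult)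

lemma diff_subfield_det:
  fixes A :: "'a::field^'n^'n"
  assumes "diff_subfield \<delta> K" "\<And>i j. A $ i $ j \<in> K"
  shows "det A \<in> K"
proof -
  have "of_int (sign p) \<in> K" for p :: "'n \<Rightarrow> 'n"
    using assms(1) by (cases p rule: sign_cases) (simp_all add: diff_subfield_1 diff_subfield_uminus)
  then show ?thesis
    unfolding det_def using assms by (intro diff_subfield_sum diff_subfield_mult diff_subfield_prod) auto
qed

lemma diff_subfield_matrix_mult:
  fixes A B :: "'a::field^'n^'n"
  assumes "diff_subfield \<delta> K" "\<And>i j. A $ i $ j \<in> K" "\<And>i j. B $ i $ j \<in> K"
  shows "(A ** B) $ i $ j \<in> K"
  using assms by (auto simp: matrix_matrix_mult_def intro!: diff_subfield_sum diff_subfield_mult)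

lemma invertible_matrix_inv:
  fixes F :: "'a::field^'n^'n"
  assumes "invertible F"
  shows "F ** matrix_inv F = mat 1" "matrix_inv F ** F = mat 1"
  using someI_ex[of "\<lambda>A'. F ** A' = mat 1 \<and> A' ** F = mat 1"] assms
  by (auto simp: invertible_def matrix_inv_def)

text \<open>Each column of the inverse solves a linear system with a unit vector on the right, so
  Cramer's rule writes its entries as quotients of determinants over \<open>K\<close>.\<close>

lemma diff_subfield_matrix_inv:
  fixes F :: "'a::field^'n^'n"
  assumes K: "diff_subfield \<delta> K" and F: "\<And>i j. F $ i $ j \<in> K" "invertible F"
  shows "matrix_inv F $ i $ j \<in> K"
proof -
  have d: "det F \<noteq> 0" using F(2) by (simp add: invertible_det_nz)
  have "F *v column j (matrix_inv F) = column j (mat 1)"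
    unfolding invertible_matrix_inv(1)[OF F(2), symmetric]
    by (simp add: vec_eq_iff column_def matrix_vector_mult_def matrix_matrix_mult_def)
  then have "column j (matrix_inv F)
      = (\<chi> k. det (\<chi> i' j'. if j' = k then column j (mat 1) $ i' else F $ i' $ j') / det F)"
    by (simp only: cramer[OF d])
  from arg_cong[OF this, of "\<lambda>v. v $ i"]
  have "matrix_inv F $ i $ j
      = det (\<chi> i' j'. if j' = i then column j (mat 1) $ i' else F $ i' $ j') / det F"
    by (simp only: column_def vec_lambda_beta)
  also have "\<dots> \<in> K"
  proof (intro diff_subfield_divide[OF K] diff_subfield_det[OF K] F(1))
    fix i' j'
    have "mat 1 $ i' $ j \<in> K" using K by (simp add: mat_def diff_subfield_0 diff_subfield_1)
    then show "(\<chi> i' j'. if j' = i then column j (mat 1) $ i' else F $ i' $ j') $ i' $ j' \<in> K"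
      using F(1) by (simp add: column_def)
  qed
  finally show ?thesis .
qed

lemma diff_hom_0: "diff_hom d K \<delta> \<iota> \<Longrightarrow> diff_subfield d K \<Longrightarrow> \<iota> 0 = 0"
proof -
  assume "diff_hom d K \<delta> \<iota>" "diff_subfield d K"
  then have "\<iota> (0 + 0) = \<iota> 0 + \<iota> 0" using diff_subfield_0 unfolding diff_hom_def by blast
  then show ?thesis by (metis add.right_neutral add_left_cancel)
qed

text \<open>\<open>diff_hom\<close> speaks of 1, sums, products and derivatives only. Differences
  come from \<open>x = (x - y) + y\<close>, and inverses from the uniqueness of inverses in a
  field.\<close>

lemma diff_subfield_image:
  assumes h: "diff_hom d K \<delta> \<iota>" and K: "diff_subfield d K"
  shows "diff_subfield \<delta> (\<iota> ` K)"
proof -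
  have add: "\<iota> (x + y) = \<iota> x + \<iota> y" and mult: "\<iota> (x * y) = \<iota> x * \<iota> y" and der: "\<iota> (d x) = \<delta> (\<iota> x)"
    if "x \<in> K" "y \<in> K" for x y
    using h that by (auto simp: diff_hom_def)
  have one: "\<iota> 1 = 1" using h by (simp add: diff_hom_def)
  note zero = diff_hom_0[OF h K]
  show ?thesis
    unfolding diff_subfield_def ball_simps
  proof (intro conjI ballI)
    show "1 \<in> \<iota> ` K" using one diff_subfield_1[OF K] by (metis imageI)
    fix x assume x: "x \<in> K"
    show "\<delta> (\<iota> x) \<in> \<iota> ` K" using der[OF x x] diff_subfield_deriv[OF K x] by (metis imageI)
    have "inverse (\<iota> x) = \<iota> (inverse x)"
    proof (cases "x = 0")
      case False
      have "\<iota> (inverse x) * \<iota> x = 1"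
        using mult[OF diff_subfield_inverse[OF K x] x] False one by simp
      then show ?thesis by (metis inverse_unique mult.commute)
    qed (simp add: zero)
    then show "inverse (\<iota> x) \<in> \<iota> ` K" using diff_subfield_inverse[OF K x] by simp
    fix y assume y: "y \<in> K"
    show "\<iota> x * \<iota> y \<in> \<iota> ` K" using mult[OF x y] diff_subfield_mult[OF K x y] by (metis imageI)
    have "\<iota> x - \<iota> y = \<iota> (x - y)"
      using add[OF diff_subfield_diff[OF K x y] y] by simp
    then show "\<iota> x - \<iota> y \<in> \<iota> ` K" using diff_subfield_diff[OF K x y] by simp
  qed
qed

text \<open>Elements of \<open>Bij K\<close> are extensional, so an automorphism that fixes all of
  \<open>K\<close> is exactly one function.\<close>

lemma DGal_self_iso_singleton:
  assumes K: "diff_subfield \<delta> K"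
  shows "DGal \<delta> K K \<cong> singleton_group ()"
proof -
  have "(\<lambda>x\<in>K. x) \<in> carrier (DGal \<delta> K K)"
    using K by (simp add: DGal_def id_Bij diff_subfield_add diff_subfield_mult diff_subfield_deriv)
  moreover have "\<sigma> = (\<lambda>x\<in>K. x)" if "\<sigma> \<in> carrier (DGal \<delta> K K)" for \<sigma>
    using that by (auto simp: DGal_def Bij_def intro!: extensionalityI[of _ K])
  ultimately have "carrier (DGal \<delta> K K) = {\<lambda>x\<in>K. x}" by blast
  then have "(\<lambda>_. ()) \<in> iso (DGal \<delta> K K) (singleton_group ())"
    by (simp add: iso_def hom_def bij_betw_def singleton_group_def)
  then show ?thesis by (auto simp: is_iso_def)
qed

text \<open>\<open>L\<close> is the smallest differential field containing \<open>K\<close> and the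
  solutions, and \<open>K\<close> itself is such a field.\<close>

lemma picard_vessiot_eq_base:
  assumes "picard_vessiot \<delta> K L A b"
    and sol: "\<And>\<xi> i. \<xi> \<in> linear_solutions \<delta> L A b \<Longrightarrow> \<xi> $ i \<in> K"
  shows "L = K"
proof -
  have "K \<in> {F. diff_subfield \<delta> F \<and> K \<union> {\<xi> $ i | \<xi> i. \<xi> \<in> linear_solutions \<delta> L A b} \<subseteq> F}"
    using assms by (auto simp: picard_vessiot_def)
  moreover have "L = diff_generated \<delta> (K \<union> {\<xi> $ i | \<xi> i. \<xi> \<in> linear_solutions \<delta> L A b})" "K \<subseteq> L"
    using assms(1) unfolding picard_vessiot_def by blast+
  ultimately show ?thesis unfolding diff_generated_def by blast
qed

text \<open>A solution in \<open>L\<close> differs from \<open>B\<close> by a constant, and the constants of \<open>L\<close> lie in \<open>K\<close>.\<close>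

lemma picard_vessiot_antiderivative:
  assumes pv: "picard_vessiot \<delta> K L (0 :: 'a::field^1^1) (\<chi> i. b)" and B: "B \<in> K" "\<delta> B = b"
  shows "L = K"
proof (rule picard_vessiot_eq_base[OF pv])
  fix \<xi> :: "'a^1" and i :: 1
  have \<delta>: "derivation \<delta>" and K: "diff_subfield \<delta> K" and L: "diff_subfield \<delta> L" "K \<subseteq> L"
    and C: "constants \<delta> L = constants \<delta> K"
    using pv by (auto simp: picard_vessiot_def)
  assume sol: "\<xi> \<in> linear_solutions \<delta> L 0 (\<chi> i. b)"
  then have \<xi>: "\<xi> $ i \<in> L" unfolding linear_solutions_def by blast
  have "(\<chi> i. \<delta> (\<xi> $ i)) $ i = (0 *v \<xi> + (\<chi> i. b)) $ i"
    using sol unfolding linear_solutions_def by (simp only: mem_Collect_eq)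
  then have "\<delta> (\<xi> $ i) = b" by (simp only: vec_lambda_beta vector_add_component) simp
  then have "\<xi> $ i - B \<in> constants \<delta> L"
    using B L \<delta> \<xi> by (auto simp: constants_def derivation_diff intro!: diff_subfield_diff)
  then have "\<xi> $ i - B \<in> K" unfolding C by (simp add: constants_def)
  then show "\<xi> $ i \<in> K" using diff_subfield_add[OF K _ B(1)] by force
qed

text \<open>The slope has the antiderivative \<open>[:0, 0, c:]\<close> among the polynomials, and
  \<open>\<iota>\<close> carries this fact into the ambient field.\<close>

lemma foliation_DGal:
  assumes h: "diff_hom rat_deriv UNIV \<delta> \<iota>"
    and pv: "picard_vessiot \<delta> (range \<iota>) L (0 :: 'a::field^1^1) (\<chi> i. \<iota> (to_fract [:0, 2 * c:]))"
  shows "DGal \<delta> (range \<iota>) L \<cong> singleton_group ()"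
proof -
  have "diff_subfield rat_deriv UNIV" by (simp add: diff_subfield_def)
  from diff_subfield_image[OF h this] have K: "diff_subfield \<delta> (range \<iota>)" .
  have "rat_deriv (to_fract [:0, 0, c:]) = to_fract [:0, 2 * c:]"
    by (simp add: to_fract_def rat_deriv_Fract pderiv_pCons)
  then have "\<delta> (\<iota> (to_fract [:0, 0, c:])) = \<iota> (to_fract [:0, 2 * c:])"
    using h unfolding diff_hom_def by (metis UNIV_I)
  from picard_vessiot_antiderivative[OF pv _ this] have "L = range \<iota>" by blast
  with DGal_self_iso_singleton[OF K] show ?thesis by simp
qed

lemma foliation_slope_quad_field: "foliation_slope (quad_field c) [:0, 2 * c:]"
  by (auto simp: foliation_slope_def quad_field_def mult_ac)

section \<open>Automorphism groups, and commutativity from first-order equations\<close>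

section \<open>Differential Galois groups\<close>

lemma DGal_carrierD:
  assumes "\<sigma> \<in> carrier (DGal \<delta> K L)"
  shows DGal_Bij: "\<sigma> \<in> Bij L"
    and DGal_closed: "x \<in> L \<Longrightarrow> \<sigma> x \<in> L"
    and DGal_add: "x \<in> L \<Longrightarrow> y \<in> L \<Longrightarrow> \<sigma> (x + y) = \<sigma> x + \<sigma> y"
    and DGal_mult: "x \<in> L \<Longrightarrow> y \<in> L \<Longrightarrow> \<sigma> (x * y) = \<sigma> x * \<sigma> y"
    and DGal_deriv: "x \<in> L \<Longrightarrow> \<sigma> (\<delta> x) = \<delta> (\<sigma> x)"
    and DGal_fixes: "x \<in> K \<Longrightarrow> \<sigma> x = x"
  using assms by (auto simp: DGal_def Bij_def bij_betw_def)

lemma DGal_comp: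
  assumes "\<sigma> \<in> carrier (DGal \<delta> K L)" "\<tau> \<in> carrier (DGal \<delta> K L)"
  shows "\<sigma> \<otimes>\<^bsub>DGal \<delta> K L\<^esub> \<tau> = compose L \<sigma> \<tau>"
  using assms by (simp add: DGal_def BijGroup_def)

locale diff_extension =
  fixes \<delta> :: "'a::field \<Rightarrow> 'a" and K L :: "'a set"
  assumes der: "derivation \<delta>" and base: "diff_subfield \<delta> K" and ext: "diff_subfield \<delta> L"
    and sub: "K \<subseteq> L"
begin

abbreviation G :: "('a \<Rightarrow> 'a) monoid" where "G \<equiv> DGal \<delta> K L"

lemma DGal_diff:
  assumes "\<sigma> \<in> carrier G" "x \<in> L" "y \<in> L"
  shows "\<sigma> (x - y) = \<sigma> x - \<sigma> y"
  using DGal_add[OF assms(1) diff_subfield_diff[OF ext assms(2,3)] assms(3)] by simp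

lemma DGal_inverse:
  assumes "\<sigma> \<in> carrier G" "x \<in> L"
  shows "\<sigma> (inverse x) = inverse (\<sigma> x)"
proof (cases "x = 0")
  case True
  then show ?thesis using DGal_fixes[OF assms(1) diff_subfield_0[OF base]] by simp
next
  case False
  then have "\<sigma> (inverse x) * \<sigma> x = 1"
    using DGal_mult[OF assms(1) diff_subfield_inverse[OF ext assms(2)] assms(2)]
      DGal_fixes[OF assms(1) diff_subfield_1[OF base]] by simp
  then show ?thesis by (metis inverse_unique mult.commute)
qed

lemma DGal_sum:
  assumes "\<sigma> \<in> carrier G" "\<And>i. i \<in> S \<Longrightarrow> f i \<in> L"
  shows "\<sigma> (sum f S) = (\<Sum>i\<in>S. \<sigma> (f i))"
  using assms(2)
proof (induction S rule: infinite_finite_induct)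
  case (insert i S)
  then have "\<sigma> (f i + sum f S) = \<sigma> (f i) + \<sigma> (sum f S)"
    using ext by (intro DGal_add[OF assms(1)] diff_subfield_sum) auto
  with insert show ?case by simp
qed (use DGal_fixes[OF assms(1) diff_subfield_0[OF base]] in simp_all)

text \<open>\<open>DGal\<close> has the operations of \<open>BijGroup L\<close> with a smaller
  carrier, so it is enough that the carrier is a subgroup.\<close>

lemma group_DGal: "group G"
proof -
  have "subgroup (carrier G) (BijGroup L)"
  proof (rule group.subgroupI[OF group_BijGroup])
    show "carrier G \<subseteq> carrier (BijGroup L)" by (auto simp: BijGroup_def DGal_def)
    have "(\<lambda>x\<in>L. x) \<in> carrier G"
      using ext sub
      by (auto simp: DGal_def id_Bij diff_subfield_add diff_subfield_mult diff_subfield_deriv)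
    then show "carrier G \<noteq> {}" by blast
  next
    fix \<sigma> assume \<sigma>: "\<sigma> \<in> carrier G"
    define \<rho> where "\<rho> = (\<lambda>x\<in>L. inv_into L \<sigma> x)"
    have bij: "bij_betw \<sigma> L L" using DGal_Bij[OF \<sigma>] by (simp add: Bij_def)
    \<comment> \<open>Every identity for the inverse \<open>\<rho>\<close> follows by applying
      \<open>\<sigma>\<close> to its right-hand side.\<close>
    have eqI: "\<rho> x = y" if "y \<in> L" "\<sigma> y = x" for x y
      using that bij by (auto simp: \<rho>_def bij_betw_def inv_into_f_f)
    have R: "\<rho> x \<in> L" "\<sigma> (\<rho> x) = x" if "x \<in> L" for x
      using that bij by (auto simp: \<rho>_def bij_betw_inv_into_right bij_betw_def inv_into_into)
    have "\<rho> \<in> carrier G"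
      unfolding DGal_def
    proof (simp, intro conjI ballI)
      show "\<rho> \<in> Bij L" unfolding \<rho>_def by (rule restrict_inv_into_Bij[OF DGal_Bij[OF \<sigma>]])
      fix x assume x: "x \<in> L"
      show "\<rho> (\<delta> x) = \<delta> (\<rho> x)"
        using R[OF x] by (intro eqI) (simp_all add: diff_subfield_deriv[OF ext] DGal_deriv[OF \<sigma>])
      fix y assume y: "y \<in> L"
      show "\<rho> (x + y) = \<rho> x + \<rho> y"
        using R[OF x] R[OF y] by (intro eqI) (simp_all add: diff_subfield_add[OF ext] DGal_add[OF \<sigma>])
      show "\<rho> (x * y) = \<rho> x * \<rho> y"
        using R[OF x] R[OF y] by (intro eqI) (simp_all add: diff_subfield_mult[OF ext] DGal_mult[OF \<sigma>])
    next
      fix x assume "x \<in> K"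
      then show "\<rho> x = x" using sub by (intro eqI DGal_fixes[OF \<sigma>]) auto
    qed
    then show "inv\<^bsub>BijGroup L\<^esub> \<sigma> \<in> carrier G"
      by (simp add: inv_BijGroup[OF DGal_Bij[OF \<sigma>]] \<rho>_def)
    fix \<tau> assume \<tau>: "\<tau> \<in> carrier G"
    have "compose L \<sigma> \<tau> \<in> Bij L"
      using \<sigma> \<tau> by (intro compose_Bij DGal_Bij)
    then have "compose L \<sigma> \<tau> \<in> carrier G"
      using ext sub
      by (auto simp: DGal_def compose_eq diff_subfield_add diff_subfield_mult diff_subfield_deriv
          DGal_closed[OF \<tau>] DGal_add[OF \<tau>] DGal_add[OF \<sigma>] DGal_mult[OF \<tau>] DGal_mult[OF \<sigma>]
          DGal_deriv[OF \<tau>] DGal_deriv[OF \<sigma>] DGal_fixes[OF \<tau>] DGal_fixes[OF \<sigma>] subset_iff)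
    then show "\<sigma> \<otimes>\<^bsub>BijGroup L\<^esub> \<tau> \<in> carrier G"
      using DGal_Bij[OF \<sigma>] DGal_Bij[OF \<tau>] by (simp add: BijGroup_def)
  qed
  from subgroup.subgroup_is_group[OF this group_BijGroup]
  show ?thesis by (simp add: DGal_def)
qed

text \<open>The elements on which \<open>\<sigma>\<close> and \<open>\<tau>\<close> commute form a
  differential field containing \<open>K\<close> and \<open>S\<close>, hence all of \<open>L\<close>
  by minimality.\<close>

lemma DGal_commute_generated:
  assumes \<sigma>: "\<sigma> \<in> carrier G" and \<tau>: "\<tau> \<in> carrier G" and gen: "L = diff_generated \<delta> (K \<union> S)"
    and S: "\<And>x. x \<in> S \<Longrightarrow> x \<in> L \<and> \<sigma> (\<tau> x) = \<tau> (\<sigma> x)"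
  shows "\<sigma> \<otimes>\<^bsub>G\<^esub> \<tau> = \<tau> \<otimes>\<^bsub>G\<^esub> \<sigma>"
proof -
  define F where "F = {x \<in> L. \<sigma> (\<tau> x) = \<tau> (\<sigma> x)}"
  have K: "K \<subseteq> F" using sub by (auto simp: F_def DGal_fixes[OF \<sigma>] DGal_fixes[OF \<tau>])
  have "diff_subfield \<delta> F"
    using ext K diff_subfield_1[OF base] unfolding diff_subfield_def F_def
    by (auto simp: DGal_closed[OF \<sigma>] DGal_closed[OF \<tau>] DGal_diff[OF \<sigma>] DGal_diff[OF \<tau>]
        DGal_mult[OF \<sigma>] DGal_mult[OF \<tau>] DGal_inverse[OF \<sigma>] DGal_inverse[OF \<tau>]
        DGal_deriv[OF \<sigma>] DGal_deriv[OF \<tau>])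
  moreover have "K \<union> S \<subseteq> F" using K S by (auto simp: F_def)
  ultimately have "L \<subseteq> F" unfolding gen diff_generated_def by blast
  then have "compose L \<sigma> \<tau> = compose L \<tau> \<sigma>"
    by (auto simp: compose_def F_def fun_eq_iff)
  then show ?thesis by (simp add: DGal_comp \<sigma> \<tau>)
qed

end

text \<open>When \<open>z' = g z\<close> has a nonzero solution in \<open>K\<close>, automorphisms translate \<open>u\<close> by elements of \<open>K\<close>.
  When \<open>g\<close> is a nonzero constant, \<open>u + w/g\<close> solves the homogeneous equation, and automorphisms rescale
  it by elements of \<open>K\<close>.\<close>

lemma (in diff_extension) DGal_commute_first_order:
  assumes C: "constants \<delta> L = constants \<delta> K"
    and u: "u \<in> L" "\<delta> u = g * u + w" and g: "g \<in> K" and w: "w \<in> K" "\<delta> w = 0"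
    and cases: "(\<exists>z\<in>K. z \<noteq> 0 \<and> \<delta> z = g * z) \<or> (g \<noteq> 0 \<and> \<delta> g = 0)"
    and \<sigma>: "\<sigma> \<in> carrier G" and \<tau>: "\<tau> \<in> carrier G"
  shows "\<sigma> (\<tau> u) = \<tau> (\<sigma> u)"
  using cases
proof (elim disjE bexE conjE)
  fix z assume z: "z \<in> K" "z \<noteq> 0" "\<delta> z = g * z"
  \<comment> \<open>The inhomogeneous term cancels in \<open>\<rho> u - u\<close>, which is
    therefore a constant multiple of \<open>z\<close>. The constant lies in \<open>K\<close> as
    there are no new constants.\<close>
  have *: "\<exists>d\<in>K. \<rho> u = u + d" if \<rho>: "\<rho> \<in> carrier G" for \<rho>
  proof -
    have "\<delta> (\<rho> u) = \<rho> (g * u + w)" using DGal_deriv[OF \<rho> u(1)] u(2) by simp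
    also have "\<dots> = g * \<rho> u + w"
      using u g w sub ext
      by (simp add: DGal_add[OF \<rho>] DGal_mult[OF \<rho>] DGal_fixes[OF \<rho>] diff_subfield_mult subset_iff)
    finally have "\<delta> (\<rho> u - u) = g * (\<rho> u - u)" using der u by (simp add: derivation_diff algebra_simps)
    then have "\<delta> ((\<rho> u - u) / z) = 0" using derivation_quotient_eq_0 der z by blast
    moreover have "(\<rho> u - u) / z \<in> L"
      using u(1) z(1) sub ext by (intro diff_subfield_divide[OF ext] diff_subfield_diff[OF ext] DGal_closed[OF \<rho>]) auto
    ultimately have "(\<rho> u - u) / z \<in> constants \<delta> K" using C by (auto simp: constants_def)
    then have "(\<rho> u - u) / z * z \<in> K" using z base by (intro diff_subfield_mult) (auto simp: constants_def)
    then show ?thesis using z by (intro bexI[of _ "\<rho> u - u"]) simp_all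
  qed
  obtain d where d: "d \<in> K" "\<sigma> u = u + d" using *[OF \<sigma>] by blast
  obtain e where e: "e \<in> K" "\<tau> u = u + e" using *[OF \<tau>] by blast
  show ?thesis
    using d e u sub by (simp add: DGal_add[OF \<sigma>] DGal_add[OF \<tau>] DGal_fixes[OF \<sigma>] DGal_fixes[OF \<tau>] subset_iff)
next
  assume g0: "g \<noteq> 0" "\<delta> g = 0"
  define k where "k = w / g"
  have k: "k \<in> K" using w g base by (simp add: k_def diff_subfield_divide)
  \<comment> \<open>Both \<open>w\<close> and \<open>g\<close> are constants, so the quotient rule
    applies with growth rate 0.\<close>
  have "\<delta> k = 0"
    unfolding k_def using derivation_quotient_eq_0[OF der, of w 0 g] w g0 by simp
  define v where "v = u + k"
  have v: "v \<in> L" using u(1) k sub ext by (auto simp: v_def intro: diff_subfield_add)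
  have dv: "\<delta> v = g * v"
    using der u \<open>\<delta> k = 0\<close> g0 by (simp add: v_def derivation_add k_def algebra_simps)
  \<comment> \<open>Both \<open>\<rho> v\<close> and \<open>v\<close> solve the homogeneous
    equation, so their ratio is a constant. The case \<open>v = 0\<close>, where the ratio carries
    no information, is separate.\<close>
  have *: "\<exists>m\<in>K. \<rho> v = m * v" if \<rho>: "\<rho> \<in> carrier G" for \<rho>
  proof (cases "v = 0")
    case True
    then show ?thesis
      using DGal_fixes[OF \<rho> diff_subfield_0[OF base]] diff_subfield_0[OF base] by auto
  next
    case False
    have "\<delta> (\<rho> v) = g * \<rho> v"
      using DGal_deriv[OF \<rho> v] dv DGal_mult[OF \<rho> _ v, of g] DGal_fixes[OF \<rho> g] g sub by auto
    then have "\<delta> (\<rho> v / v) = 0" using derivation_quotient_eq_0[OF der _ dv False] by blast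
    then have "\<rho> v / v \<in> constants \<delta> L"
      using v ext DGal_closed[OF \<rho> v] by (simp add: constants_def diff_subfield_divide)
    then have "\<rho> v / v \<in> K" unfolding C by (simp add: constants_def)
    then show ?thesis using False by (intro bexI[of _ "\<rho> v / v"]) simp_all
  qed
  obtain m where m: "m \<in> K" "\<sigma> v = m * v" using *[OF \<sigma>] by blast
  obtain n where n: "n \<in> K" "\<tau> v = n * v" using *[OF \<tau>] by blast
  have "\<sigma> (\<tau> v) = \<tau> (\<sigma> v)"
    using m n v sub by (simp add: DGal_mult[OF \<sigma>] DGal_mult[OF \<tau>] DGal_fixes[OF \<sigma>] DGal_fixes[OF \<tau>] subset_iff)
  moreover have "\<sigma> (\<tau> v) = \<sigma> (\<tau> u) + k" "\<tau> (\<sigma> v) = \<tau> (\<sigma> u) + k"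
    using u k sub by (simp_all add: v_def DGal_add[OF \<sigma>] DGal_add[OF \<tau>] DGal_fixes[OF \<sigma>] DGal_fixes[OF \<tau>]
        DGal_closed[OF \<sigma>] DGal_closed[OF \<tau>] subset_iff)
  ultimately show ?thesis by simp
qed

lemma picard_vessiot_diff_extension: "picard_vessiot \<delta> K L A b \<Longrightarrow> diff_extension \<delta> K L"
  by (simp add: picard_vessiot_def diff_extension_def)

text \<open>For \<open>\<xi>\<close> a solution, \<open>\<xi>\<^sub>2 - c x \<xi>\<^sub>1\<close> is a constant, since \<open>c y \<xi>\<^sub>1 + c x \<xi>\<^sub>2\<close> is the derivative of \<open>c x \<xi>\<^sub>1\<close>.\<close>

lemma comm_group_DGal_variational:
  fixes A :: "'a::field^2^2"
  assumes pv: "picard_vessiot \<delta> K L A 0"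
    and A: "A $ 1 $ 1 = 0" "A $ 1 $ 2 = 1" "A $ 2 $ 1 = c * y" "A $ 2 $ 2 = c * x"
    and xy: "x \<in> K" "y \<in> K" "\<delta> x = y" "\<delta> y = c * x * y" and c: "c \<in> K" "\<delta> c = 0" "c \<noteq> 0"
  shows "comm_group (DGal \<delta> K L)"
proof -
  interpret diff_extension \<delta> K L by (rule picard_vessiot_diff_extension[OF pv])
  have C: "constants \<delta> L = constants \<delta> K"
    and gen: "L = diff_generated \<delta> (K \<union> {\<xi> $ i | \<xi> i. \<xi> \<in> linear_solutions \<delta> L A 0})"
    using pv unfolding picard_vessiot_def by blast+
  have cx: "c * x \<in> K" "\<delta> (c * x) = c * y"
    using c xy base der by (auto simp: diff_subfield_mult derivation_mult)
  \<comment> \<open>If \<open>y\<close> is nonzero, it is the required solution itself. If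
    \<open>y = 0\<close>, then \<open>c * x\<close> is a constant: either it is zero and 1 is a
    solution, or it is a nonzero constant.\<close>
  have cases: "(\<exists>z\<in>K. z \<noteq> 0 \<and> \<delta> z = (c * x) * z) \<or> (c * x \<noteq> 0 \<and> \<delta> (c * x) = 0)"
  proof (cases "y = 0")
    case True
    show ?thesis
    proof (cases "x = 0")
      case x0: True
      show ?thesis using diff_subfield_1[OF base] derivation_1[OF der] x0 by (intro disjI1 bexI[of _ 1]) simp_all
    qed (use True c cx in simp)
  next
    case False
    then show ?thesis using xy by (intro disjI1 bexI[of _ y]) simp_all
  qed
  show ?thesis
  proof (rule group.group_comm_groupI[OF group_DGal])
    fix \<sigma> \<tau> assume \<sigma>: "\<sigma> \<in> carrier G" and \<tau>: "\<tau> \<in> carrier G"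
    show "\<sigma> \<otimes>\<^bsub>G\<^esub> \<tau> = \<tau> \<otimes>\<^bsub>G\<^esub> \<sigma>"
    proof (rule DGal_commute_generated[OF \<sigma> \<tau> gen])
      fix s assume "s \<in> {\<xi> $ i | \<xi> i. \<xi> \<in> linear_solutions \<delta> L A 0}"
      then obtain \<xi> :: "'a^2" and i where s: "s = \<xi> $ i" and \<xi>: "\<xi> \<in> linear_solutions \<delta> L A 0" by blast
      have L: "\<xi> $ 1 \<in> L" "\<xi> $ 2 \<in> L"
        and d1: "\<delta> (\<xi> $ 1) = \<xi> $ 2" and d2: "\<delta> (\<xi> $ 2) = c * y * \<xi> $ 1 + c * x * \<xi> $ 2"
        using \<xi> A by (auto simp: linear_solutions_def vec_eq_iff forall_2 matrix_vector_mult_def sum_2)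
      define w where "w = \<xi> $ 2 - c * x * \<xi> $ 1"
      have "w \<in> L" unfolding w_def using L cx sub ext by (blast intro: diff_subfield_diff diff_subfield_mult)
      moreover have dw: "\<delta> w = 0"
        using der cx(2) d1 d2 by (simp add: w_def derivation_diff derivation_mult)
      ultimately have w: "w \<in> K" using C by (auto simp: constants_def)
      have "\<delta> (\<xi> $ 1) = (c * x) * \<xi> $ 1 + w" using d1 by (simp add: w_def)
      note comm = DGal_commute_first_order[OF C L(1) this cx(1) w dw cases \<sigma> \<tau>]
      \<comment> \<open>The second component is the derivative of the first, and automorphisms
        commute with \<open>\<delta>\<close>.\<close>
      moreover have "\<sigma> (\<tau> (\<xi> $ 2)) = \<tau> (\<sigma> (\<xi> $ 2))"
        unfolding d1[symmetric]
        using comm L DGal_closed[OF \<sigma>] DGal_closed[OF \<tau>] DGal_deriv[OF \<sigma>] DGal_deriv[OF \<tau>] by metis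
      ultimately show "s \<in> L \<and> \<sigma> (\<tau> s) = \<tau> (\<sigma> s)"
        using L exhaust_2[of i] s by auto
    qed
  qed
qed

section \<open>The matrix representation, its Zariski topology and the identity component\<close>

lemma matrix_polynomial_sum:
  assumes "0 \<in> C" "\<And>k. k \<in> S \<Longrightarrow> matrix_polynomial C (f k)"
  shows "matrix_polynomial C (\<lambda>M. \<Sum>k\<in>S. f k M)"
  using assms(2)
  by (induction S rule: infinite_finite_induct)
    (auto intro: matrix_polynomial.const[OF assms(1)] matrix_polynomial.add)

text \<open>The entries of \<open>N ** M\<close> are linear forms in those of \<open>M\<close> with
  coefficients in \<open>C\<close>. This is the algebraic content of the continuity of left
  translations.\<close>

lemma matrix_polynomial_left_mult:
  fixes N :: "'a::field^'n^'n"
  assumes "matrix_polynomial C p" "0 \<in> C" "\<And>i j. N $ i $ j \<in> C"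
  shows "matrix_polynomial C (\<lambda>M. p (N ** M))"
  using assms(1)
proof induction
  case (entry i j)
  show ?case
    unfolding matrix_matrix_mult_def vec_lambda_beta
    by (intro matrix_polynomial_sum matrix_polynomial.mult matrix_polynomial.const
        matrix_polynomial.entry assms)
qed (auto intro: matrix_polynomial.intros)

locale galois_representation = diff_extension \<delta> K L
  for \<delta> :: "'a::field \<Rightarrow> 'a" and K L +
  fixes A F :: "'a^'n^'n"
  assumes no_new_constants: "constants \<delta> L = constants \<delta> K"
    and coefficients: "\<And>i j. A $ i $ j \<in> K"
    and fundamental: "fundamental_matrix \<delta> L A F"
begin

abbreviation act :: "('a \<Rightarrow> 'a) \<Rightarrow> 'a^'n^'n" where "act \<sigma> \<equiv> \<chi> i j. \<sigma> (F $ i $ j)"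
abbreviation M :: "('a \<Rightarrow> 'a) \<Rightarrow> 'a^'n^'n" where "M \<equiv> galois_matrix F"
abbreviation X :: "('a \<Rightarrow> 'a) topology" where "X \<equiv> DGal_topology \<delta> K L F"

lemma F_entries: "F $ i $ j \<in> L"
  and F_invertible: "invertible F"
  and F_deriv: "\<delta> (F $ i $ j) = (\<Sum>k\<in>UNIV. A $ i $ k * F $ k $ j)"
  using fundamental by (auto simp: fundamental_matrix_def vec_eq_iff matrix_matrix_mult_def)

lemma F_galois_matrix: "F ** M \<sigma> = act \<sigma>"
  by (simp add: galois_matrix_def matrix_mul_assoc invertible_matrix_inv(1)[OF F_invertible])

text \<open>Both \<open>F\<close> and its image \<open>act \<sigma>\<close> solve the linear system.
  Differentiating \<open>F ** M \<sigma> = act \<sigma>\<close> thus leaves \<open>F\<close> times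
  the derivative of \<open>M \<sigma>\<close> equal to zero, and \<open>F\<close> is
  invertible.\<close>

lemma galois_matrix_entries:
  assumes \<sigma>: "\<sigma> \<in> carrier G"
  shows "M \<sigma> $ i $ j \<in> constants \<delta> K"
proof -
  have inL: "M \<sigma> $ i $ j \<in> L" for i j
    unfolding galois_matrix_def
    by (rule diff_subfield_matrix_mult[OF ext diff_subfield_matrix_inv[OF ext F_entries F_invertible]])
      (simp add: DGal_closed[OF \<sigma>] F_entries)
  define D where "D = (\<chi> i j. \<delta> (M \<sigma> $ i $ j))"
  have "F ** D = 0"
  proof -
    have "(F ** D) $ i $ j = 0" for i j
    proof -
      have "\<delta> ((F ** M \<sigma>) $ i $ j) = \<delta> (\<sigma> (F $ i $ j))" by (simp add: F_galois_matrix)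
      also have "\<dots> = \<sigma> (\<Sum>k\<in>UNIV. A $ i $ k * F $ k $ j)"
        using DGal_deriv[OF \<sigma> F_entries] F_deriv by metis
      also have "\<dots> = (\<Sum>k\<in>UNIV. A $ i $ k * \<sigma> (F $ k $ j))"
        using coefficients sub F_entries ext
        by (subst DGal_sum[OF \<sigma>]) (auto simp: DGal_mult[OF \<sigma>] DGal_fixes[OF \<sigma>] diff_subfield_mult subset_iff)
      also have "\<dots> = (A ** (F ** M \<sigma>)) $ i $ j"
        unfolding matrix_matrix_mult_def[of A] by (simp add: F_galois_matrix)
      finally have 1: "\<delta> ((F ** M \<sigma>) $ i $ j) = ((A ** F) ** M \<sigma>) $ i $ j"
        by (simp add: matrix_mul_assoc)
      have AF: "(A ** F) $ i $ k = \<delta> (F $ i $ k)" for i k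
        by (simp add: F_deriv matrix_matrix_mult_def)
      \<comment> \<open>The product rule computes the same derivative a second way, and comparing
        with \<open>1\<close> isolates \<open>F ** D\<close>.\<close>
      have "\<delta> ((F ** M \<sigma>) $ i $ j) = (\<Sum>k\<in>UNIV. \<delta> (F $ i $ k) * M \<sigma> $ k $ j) + (F ** D) $ i $ j"
        by (simp add: matrix_matrix_mult_def derivation_sum[OF der] derivation_mult[OF der] sum.distrib D_def)
      also have "(\<Sum>k\<in>UNIV. \<delta> (F $ i $ k) * M \<sigma> $ k $ j) = ((A ** F) ** M \<sigma>) $ i $ j"
        unfolding matrix_matrix_mult_def[of "A ** F"] by (simp add: AF)
      finally show ?thesis using 1 by simp
    qed
    then show ?thesis by (simp add: vec_eq_iff)
  qed
  then have "matrix_inv F ** (F ** D) = 0" by (simp add: matrix_matrix_mult_def vec_eq_iff)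
  then have "D = 0" by (simp add: matrix_mul_assoc invertible_matrix_inv(2)[OF F_invertible])
  then have "\<delta> (M \<sigma> $ i $ j) = 0" by (simp add: D_def vec_eq_iff)
  then show ?thesis using inL no_new_constants by (auto simp: constants_def)
qed

text \<open>The entries of \<open>M \<tau>\<close> lie in \<open>K\<close> and are fixed by
  \<open>\<sigma>\<close>, so applying \<open>\<sigma>\<close> to \<open>F ** M \<tau>\<close>
  changes only the factor \<open>F\<close>.\<close>

lemma galois_matrix_mult:
  assumes \<sigma>: "\<sigma> \<in> carrier G" and \<tau>: "\<tau> \<in> carrier G"
  shows "M (\<sigma> \<otimes>\<^bsub>G\<^esub> \<tau>) = M \<sigma> ** M \<tau>"
proof -
  have MK: "M \<tau> $ i $ j \<in> K" for i j
    using galois_matrix_entries[OF \<tau>, of i j] by (simp add: constants_def)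
  have "act (\<sigma> \<otimes>\<^bsub>G\<^esub> \<tau>) $ i $ j = (act \<sigma> ** M \<tau>) $ i $ j" for i j
  proof -
    have "act (\<sigma> \<otimes>\<^bsub>G\<^esub> \<tau>) $ i $ j = \<sigma> ((F ** M \<tau>) $ i $ j)"
      unfolding F_galois_matrix by (simp add: DGal_comp[OF \<sigma> \<tau>] compose_eq F_entries)
    also have "\<dots> = (\<Sum>k\<in>UNIV. \<sigma> (F $ i $ k) * M \<tau> $ k $ j)"
      unfolding matrix_matrix_mult_def vec_lambda_beta
      using MK sub F_entries ext
      by (subst DGal_sum[OF \<sigma>]) (auto simp: DGal_mult[OF \<sigma>] DGal_fixes[OF \<sigma>] diff_subfield_mult subset_iff)
    finally show ?thesis by (simp add: matrix_matrix_mult_def)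
  qed
  then have "act (\<sigma> \<otimes>\<^bsub>G\<^esub> \<tau>) = act \<sigma> ** M \<tau>" by (simp add: vec_eq_iff)
  then show ?thesis by (simp add: galois_matrix_def matrix_mul_assoc)
qed

text \<open>The constant polynomial 1 vanishes nowhere, so the full matrix space is one of the
  generating open sets.\<close>

lemma topspace_zariski: "topspace (zariski (constants \<delta> K)) = (UNIV :: ('a^'n^'n) set)"
proof -
  have "1 \<in> constants \<delta> K" using diff_subfield_1[OF base] derivation_1[OF der] by (simp add: constants_def)
  then have "matrix_polynomial (constants \<delta> K) (\<lambda>M :: 'a^'n^'n. 1)" by (rule matrix_polynomial.const)
  then have "UNIV \<in> {{M :: 'a^'n^'n. p M \<noteq> 0} | p. matrix_polynomial (constants \<delta> K) p}"
    by (intro CollectI exI[of _ "\<lambda>M. 1"]) simp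
  then show ?thesis
    unfolding zariski_def topology_generated_by_topspace by (meson Union_upper top.extremum_unique)
qed

lemma topspace_DGal: "topspace X = carrier G"
  by (simp add: DGal_topology_def topspace_pullback_topology topspace_zariski)

text \<open>Under \<open>M\<close> the translation becomes multiplication by the constant matrix
  \<open>M \<sigma>\<close>, which pulls generating open sets back to generating open sets. As
  \<open>X\<close> is a pullback topology, continuity after composing with \<open>M\<close> is
  enough.\<close>

lemma continuous_left_translation:
  assumes \<sigma>: "\<sigma> \<in> carrier G"
  shows "continuous_map X X (\<lambda>\<tau>. \<sigma> \<otimes>\<^bsub>G\<^esub> \<tau>)"
proof -
  interpret G: group G by (rule group_DGal)
  let ?Z = "zariski (constants \<delta> K) :: ('a^'n^'n) topology"
  have "0 \<in> constants \<delta> K"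
    using diff_subfield_0[OF base] derivation_0[OF der] by (simp add: constants_def)
  note left = matrix_polynomial_left_mult[OF _ this galois_matrix_entries[OF \<sigma>]]
  have "continuous_map X ?Z (M \<circ> (\<lambda>\<tau>. \<sigma> \<otimes>\<^bsub>G\<^esub> \<tau>))"
    unfolding zariski_def continuous_on_generated_topo_iff
  proof (intro conjI allI impI)
    fix U assume "U \<in> {{M :: 'a^'n^'n. p M \<noteq> 0} |p. matrix_polynomial (constants \<delta> K) p}"
    then obtain p where p: "matrix_polynomial (constants \<delta> K) p" and U: "U = {M. p M \<noteq> 0}" by blast
    have "(M \<circ> (\<lambda>\<tau>. \<sigma> \<otimes>\<^bsub>G\<^esub> \<tau>)) -` U \<inter> topspace X = M -` {N. p (M \<sigma> ** N) \<noteq> 0} \<inter> carrier G"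
      by (auto simp: U topspace_DGal galois_matrix_mult[OF \<sigma>])
    moreover have "openin ?Z {N. p (M \<sigma> ** N) \<noteq> 0}"
      unfolding zariski_def
      by (intro topology_generated_by_Basis CollectI exI[of _ "\<lambda>N. p (M \<sigma> ** N)"] conjI refl left[OF p])
    ultimately show "openin X ((M \<circ> (\<lambda>\<tau>. \<sigma> \<otimes>\<^bsub>G\<^esub> \<tau>)) -` U \<inter> topspace X)"
      unfolding DGal_topology_def openin_pullback_topology by auto
  next
    show "(M \<circ> (\<lambda>\<tau>. \<sigma> \<otimes>\<^bsub>G\<^esub> \<tau>)) ` topspace X
        \<subseteq> \<Union> {{M :: 'a^'n^'n. p M \<noteq> 0} |p. matrix_polynomial (constants \<delta> K) p}"
      using topspace_zariski unfolding zariski_def topology_generated_by_topspace by simp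
  qed
  then show ?thesis
    using topspace_DGal G.m_closed[OF \<sigma>]
    unfolding DGal_topology_def by (intro continuous_map_pullback') auto
qed

text \<open>For \<open>\<sigma>\<close> in the component \<open>H\<close> of the identity, \<open>\<sigma>\<^sup>-\<^sup>1 H\<close> is connected and contains the identity.\<close>

lemma subgroup_identity_component:
  "subgroup (connected_component_of_set X \<one>\<^bsub>G\<^esub>) G"
proof -
  interpret G: group G by (rule group_DGal)
  let ?H = "connected_component_of_set X \<one>\<^bsub>G\<^esub>"
  have H: "?H \<subseteq> carrier G"
    using connected_component_of_subset_topspace[of X] topspace_DGal by blast
  have one: "\<one>\<^bsub>G\<^esub> \<in> ?H" by (simp add: connected_component_of_refl topspace_DGal)
  have quot: "inv\<^bsub>G\<^esub> \<sigma> \<otimes>\<^bsub>G\<^esub> \<tau> \<in> ?H" if \<sigma>: "\<sigma> \<in> ?H" and \<tau>: "\<tau> \<in> ?H" for \<sigma> \<tau>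
  proof -
    have \<sigma>G: "\<sigma> \<in> carrier G" using \<sigma> H by blast
    have "connectedin X ((\<lambda>\<tau>. inv\<^bsub>G\<^esub> \<sigma> \<otimes>\<^bsub>G\<^esub> \<tau>) ` ?H)"
      by (rule connectedin_continuous_map_image[OF continuous_left_translation connectedin_connected_component_of])
        (use \<sigma>G in simp)
    moreover have "\<one>\<^bsub>G\<^esub> \<in> (\<lambda>\<tau>. inv\<^bsub>G\<^esub> \<sigma> \<otimes>\<^bsub>G\<^esub> \<tau>) ` ?H"
      using \<sigma> G.l_inv[OF \<sigma>G] by (metis imageI)
    ultimately have "(\<lambda>\<tau>. inv\<^bsub>G\<^esub> \<sigma> \<otimes>\<^bsub>G\<^esub> \<tau>) ` ?H \<subseteq> ?H"
      by (rule connected_component_of_maximal)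
    then show ?thesis using \<tau> by (rule subsetD[OF _ imageI])
  qed
  have inv: "inv\<^bsub>G\<^esub> \<sigma> \<in> ?H" if "\<sigma> \<in> ?H" for \<sigma>
    using quot[OF that one] that H by auto
  show ?thesis
  proof (rule G.subgroupI[OF H])
    fix \<sigma> \<tau> assume "\<sigma> \<in> ?H" "\<tau> \<in> ?H"
    \<comment> \<open>The product is the quotient formed from the inverse of \<open>\<sigma>\<close>
      and \<open>\<tau>\<close>.\<close>
    then show "\<sigma> \<otimes>\<^bsub>G\<^esub> \<tau> \<in> ?H" using quot[OF inv[of \<sigma>], of \<tau>] H by (auto simp: subset_iff)
  qed (use one inv in auto)
qed

lemma comm_group_identity_component:
  assumes "comm_group G"
  shows "comm_group (DGal_identity_component \<delta> K L F)"
proof -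
  interpret G: comm_group G by fact
  have "group (DGal_identity_component \<delta> K L F)"
    unfolding DGal_identity_component_def
    by (rule subgroup.subgroup_is_group[OF subgroup_identity_component G.is_group])
  then show ?thesis
    by (rule group.group_comm_groupI)
      (use G.m_comm subgroup.subset[OF subgroup_identity_component] in
        \<open>auto simp: DGal_identity_component_def subset_iff\<close>)
qed

end

lemma picard_vessiot_galois_representation:
  "picard_vessiot \<delta> K L A 0 \<Longrightarrow> fundamental_matrix \<delta> L A F \<Longrightarrow> galois_representation \<delta> K L A F"
  using picard_vessiot_diff_extension[of \<delta> K L A 0]
  by (simp add: galois_representation_def galois_representation_axioms_def picard_vessiot_def)

section \<open>The first variational equation\<close>

text \<open>The product of the Taylor series is a power series expansion of the product function,
  and such expansions are unique.\<close>

lemma germ_mult: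
  assumes "f analytic_on {z}" "g analytic_on {z}"
  shows "germ z (\<lambda>t. f t * g t) = germ z f * germ z g"
proof -
  have "(\<lambda>x. f (z + x) * g (z + x)) has_fps_expansion fps_expansion f z * fps_expansion g z"
    using assms by (intro has_fps_expansion_mult analytic_at_imp_has_fps_expansion)
  moreover have "(\<lambda>x. f (z + x) * g (z + x)) has_fps_expansion fps_expansion (\<lambda>t. f t * g t) z"
    by (rule analytic_at_imp_has_fps_expansion[of "\<lambda>t. f t * g t"]) (intro analytic_on_mult assms)
  ultimately have "fps_expansion (\<lambda>t. f t * g t) z = fps_expansion f z * fps_expansion g z"
    using fps_expansion_unique_complex by blast
  then show ?thesis by (simp add: germ_def fls_times_fps_to_fls)
qed

lemma germ_const: "germ z (\<lambda>_. c) = fls_const c"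
proof -
  have "(\<lambda>_. c) has_fps_expansion fps_expansion (\<lambda>_. c) z"
    by (rule analytic_at_imp_has_fps_expansion[of "\<lambda>_. c"]) simp
  then have "fps_expansion (\<lambda>_. c) z = fps_const c"
    using fps_expansion_unique_complex has_fps_expansion_const by blast
  then show ?thesis by (simp add: germ_def)
qed

lemma germ_deriv:
  assumes T: "open T" "z \<in> T" and d: "\<And>t. t \<in> T \<Longrightarrow> (f has_field_derivative g t) (at t)"
    and g: "g analytic_on {z}"
  shows "fls_deriv (germ z f) = germ z g"
proof -
  have "f analytic_on T"
    using T d by (simp add: analytic_on_open holomorphic_on_open) blast
  then have f: "f analytic_on {z}" by (rule analytic_on_subset) (use T in simp)
  have "deriv (\<lambda>x. f (z + x)) has_fps_expansion fps_deriv (fps_expansion f z)"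
    by (intro has_fps_expansion_deriv analytic_at_imp_has_fps_expansion f)
  \<comment> \<open>The derivative is known only on \<open>T\<close>; agreement near 0 after
    translation suffices, since a power series depends only on the germ.\<close>
  moreover have "eventually (\<lambda>x. deriv (\<lambda>x. f (z + x)) x = g (z + x)) (nhds 0)"
  proof -
    have "eventually (\<lambda>x. x \<in> (\<lambda>x. z + x) -` T) (nhds 0)"
      using T by (intro eventually_nhds_in_open open_vimage continuous_intros) auto
    then show ?thesis
    proof eventually_elim
      case (elim x)
      then have "(f has_field_derivative g (z + x)) (at (z + x))" using d by simp
      then have "((\<lambda>x. f (z + x)) has_field_derivative g (z + x)) (at x)"
        using DERIV_shift[of f "g (z + x)" x z] by (simp add: add.commute)
      then show ?case by (rule DERIV_imp_deriv)
    qed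
  qed
  ultimately have "(\<lambda>x. g (z + x)) has_fps_expansion fps_deriv (fps_expansion f z)"
    by (simp add: has_fps_expansion_cong)
  with analytic_at_imp_has_fps_expansion[OF g] have "fps_expansion g z = fps_deriv (fps_expansion f z)"
    using fps_expansion_unique_complex by blast
  then show ?thesis by (simp add: germ_def fls_deriv_fps_to_fls)
qed

lemma jacobian_quad_field:
  "jacobian (quad_field c) p $ 1 $ 1 = 0" "jacobian (quad_field c) p $ 1 $ 2 = 1"
  "jacobian (quad_field c) p $ 2 $ 1 = 2 * c * snd p" "jacobian (quad_field c) p $ 2 $ 2 = 2 * c * fst p"
proof -
  have "deriv (\<lambda>x. 2 * c * x * snd p) (fst p) = 2 * c * snd p" "deriv (\<lambda>y. 2 * c * fst p * y) (snd p) = 2 * c * fst p"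
    by (auto intro!: DERIV_imp_deriv derivative_eq_intros)
  then show "jacobian (quad_field c) p $ 1 $ 1 = 0" "jacobian (quad_field c) p $ 1 $ 2 = 1"
    "jacobian (quad_field c) p $ 2 $ 1 = 2 * c * snd p" "jacobian (quad_field c) p $ 2 $ 2 = 2 * c * fst p"
    by (simp_all add: jacobian_def quad_field_def)
qed

lemma integral_curve_analytic:
  assumes "integral_curve V T \<gamma>" "z \<in> T"
  shows "(\<lambda>t. fst (\<gamma> t)) analytic_on {z}" "(\<lambda>t. snd (\<gamma> t)) analytic_on {z}"
proof -
  have "(\<lambda>t. fst (\<gamma> t)) analytic_on T" "(\<lambda>t. snd (\<gamma> t)) analytic_on T"
    using assms by (auto simp: integral_curve_def analytic_on_open holomorphic_on_open)
  then show "(\<lambda>t. fst (\<gamma> t)) analytic_on {z}" "(\<lambda>t. snd (\<gamma> t)) analytic_on {z}"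
    using assms(2) by (simp_all add: analytic_on_subset)
qed

text \<open>The equations of the vector field become identities between the germs of the
  coordinates, and \<open>\<iota>\<close> moves these into the ambient field of \<open>L\<close>,
  where the commutativity result for abstract differential fields applies.\<close>

lemma variational_identity_component:
  fixes \<delta> :: "'a::field \<Rightarrow> 'a" and a :: complex
  assumes V: "integral_curve (quad_field a) T \<gamma>" "t\<^sub>0 \<in> T" and a: "a \<noteq> 0"
    and K: "coefficient_field \<gamma> t\<^sub>0 K" and h: "diff_hom fls_deriv K \<delta> \<iota>"
    and A: "A = (\<chi> i j. \<iota> (variational_matrix (quad_field a) \<gamma> t\<^sub>0 $ i $ j))"
    and pv: "picard_vessiot \<delta> (\<iota> ` K) L A 0" and F: "fundamental_matrix \<delta> L A F"
  shows "comm_group (DGal_identity_component \<delta> (\<iota> ` K) L F)"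
proof -
  define x y c where "x = germ t\<^sub>0 (\<lambda>t. fst (\<gamma> t))" and "y = germ t\<^sub>0 (\<lambda>t. snd (\<gamma> t))" and "c = fls_const (2 * a)"
  have Kf: "diff_subfield fls_deriv K" and inK: "x \<in> K" "y \<in> K" "c \<in> K"
    using K by (auto simp: coefficient_field_def x_def y_def c_def)
  note an = integral_curve_analytic[OF V]
  have op: "open T" and d: "\<And>t. t \<in> T \<Longrightarrow> ((\<lambda>t. fst (\<gamma> t)) has_field_derivative snd (\<gamma> t)) (at t)"
      "\<And>t. t \<in> T \<Longrightarrow> ((\<lambda>t. snd (\<gamma> t)) has_field_derivative 2 * a * fst (\<gamma> t) * snd (\<gamma> t)) (at t)"
    using V by (auto simp: integral_curve_def quad_field_def case_prod_beta)
  have cx: "germ t\<^sub>0 (\<lambda>t. 2 * a * fst (\<gamma> t)) = c * x" and cy: "germ t\<^sub>0 (\<lambda>t. 2 * a * snd (\<gamma> t)) = c * y"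
    unfolding x_def y_def c_def
    using germ_mult[OF analytic_on_const an(1)] germ_mult[OF analytic_on_const an(2)]
    by (simp_all only: germ_const)
  have dx: "fls_deriv x = y" unfolding x_def y_def by (rule germ_deriv[OF op V(2) d(1) an(2)])
  have "fls_deriv y = germ t\<^sub>0 (\<lambda>t. 2 * a * fst (\<gamma> t) * snd (\<gamma> t))"
    unfolding y_def by (rule germ_deriv[OF op V(2) d(2)]) (assumption | intro analytic_intros an)+
  also have "\<dots> = c * x * y"
    unfolding cx[symmetric] y_def by (rule germ_mult) (intro analytic_intros an)+
  finally have dy: "fls_deriv y = c * x * y" .
  have dc: "fls_deriv c = 0" by (simp add: c_def)
  have mult: "\<iota> (u * v) = \<iota> u * \<iota> v" and hom_deriv: "\<iota> (fls_deriv u) = \<delta> (\<iota> u)" if "u \<in> K" "v \<in> K" for u v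
    using h that by (auto simp: diff_hom_def)
  have one: "\<iota> 1 = 1" using h by (simp add: diff_hom_def)
  note zero = diff_hom_0[OF h Kf]
  \<comment> \<open>A homomorphism that preserves 1 and products cannot kill an invertible
    element.\<close>
  have c0: "\<iota> c \<noteq> 0"
  proof
    assume "\<iota> c = 0"
    moreover have "\<iota> c * \<iota> (inverse c) = 1"
      using mult[OF inK(3) diff_subfield_inverse[OF Kf inK(3)]] a one by (simp add: c_def)
    ultimately show False by simp
  qed
  interpret galois_representation \<delta> "\<iota> ` K" L A F
    by (rule picard_vessiot_galois_representation[OF pv F])
  show ?thesis
  proof (rule comm_group_identity_component[OF comm_group_DGal_variational[OF pv]])
    show "A $ 1 $ 1 = 0" "A $ 1 $ 2 = 1" "A $ 2 $ 1 = \<iota> c * \<iota> y" "A $ 2 $ 2 = \<iota> c * \<iota> x"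
      by (simp_all add: A variational_matrix_def jacobian_quad_field germ_const cx cy zero one mult inK)
    show "\<iota> x \<in> \<iota> ` K" "\<iota> y \<in> \<iota> ` K" "\<iota> c \<in> \<iota> ` K" using inK by simp_all
    show "\<delta> (\<iota> x) = \<iota> y" using hom_deriv[OF inK(1) inK(1)] dx by simp
    show "\<delta> (\<iota> y) = \<iota> c * \<iota> x * \<iota> y"
      using hom_deriv[OF inK(2) inK(2)] dy by (simp add: mult inK diff_subfield_mult[OF Kf])
    show "\<delta> (\<iota> c) = 0" using hom_deriv[OF inK(3) inK(3)] dc zero by simp
  qed (rule c0)
qed

theorem theorem8p3:
  fixes a :: real
  assumes a: "a \<noteq> 0"
  shows
    "\<comment> \<open>(1)\<close>
     first_integral (quad_field a) (\<lambda>(x, y). y - a * x\<^sup>2) \<and>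
     first_integral (quad_field (complex_of_real a)) (\<lambda>(x, y). y - of_real a * x\<^sup>2) \<and>
     \<comment> \<open>(2)\<close>
     (\<forall>k\<^sub>1 k\<^sub>2 r s. compatible_roots a k\<^sub>1 r s \<longrightarrow>
        integral_curve (quad_field (complex_of_real a)) {t. cos (s * (k\<^sub>2 + t)) \<noteq> 0}
          (tan_curve r s k\<^sub>2) \<and>
        (\<forall>t. cos (s * (k\<^sub>2 + t)) \<noteq> 0 \<longrightarrow>
          deriv (tan_solution r s k\<^sub>2) t = of_real a * (tan_solution r s k\<^sub>2 t)\<^sup>2 + k\<^sub>1)) \<and>
     (\<forall>T \<gamma> t\<^sub>1 k\<^sub>1 r s.
        integral_curve (quad_field (complex_of_real a)) T \<gamma> \<and> connected T \<and> t\<^sub>1 \<in> T \<and>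
        snd (\<gamma> t\<^sub>1) \<noteq> 0 \<and> k\<^sub>1 = snd (\<gamma> t\<^sub>1) - of_real a * (fst (\<gamma> t\<^sub>1))\<^sup>2 \<and> k\<^sub>1 \<noteq> 0 \<and>
        compatible_roots a k\<^sub>1 r s \<longrightarrow>
        (\<exists>k\<^sub>2. \<forall>t\<in>T. cos (s * (k\<^sub>2 + t)) \<noteq> 0 \<and> \<gamma> t = tan_curve r s k\<^sub>2 t)) \<and>
     (\<forall>T \<gamma> t\<^sub>1 k\<^sub>1 r s.
        integral_curve (quad_field a) T \<gamma> \<and> connected T \<and> t\<^sub>1 \<in> T \<and>
        snd (\<gamma> t\<^sub>1) \<noteq> 0 \<and> k\<^sub>1 = snd (\<gamma> t\<^sub>1) - a * (fst (\<gamma> t\<^sub>1))\<^sup>2 \<and> k\<^sub>1 \<noteq> 0 \<and>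
        compatible_roots a (of_real k\<^sub>1) r s \<longrightarrow>
        (\<exists>k\<^sub>2. \<forall>t\<in>T. cos (s * (k\<^sub>2 + of_real t)) \<noteq> 0 \<and>
          (complex_of_real (fst (\<gamma> t)), complex_of_real (snd (\<gamma> t)))
            = tan_curve r s k\<^sub>2 (of_real t))) \<and>
     \<comment> \<open>(3)\<close>
     foliation_slope (quad_field (complex_of_real a)) [:0, 2 * of_real a:] \<and>
     (\<forall>(\<delta> :: 'u::field \<Rightarrow> 'u) \<iota> L.
        diff_hom rat_deriv UNIV \<delta> \<iota> \<and>
        picard_vessiot \<delta> (range \<iota>) L
          (0 :: 'u^1^1) (\<chi> i. \<iota> (to_fract [:0, 2 * complex_of_real a:])) \<longrightarrow>
        DGal \<delta> (range \<iota>) L \<cong> singleton_group ()) \<and>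
     \<comment> \<open>(4)\<close>
     (\<forall>T \<gamma> t\<^sub>0 K (\<delta> :: 'v::field \<Rightarrow> 'v) \<iota> L A F.
        integral_curve (quad_field (complex_of_real a)) T \<gamma> \<and> t\<^sub>0 \<in> T \<and>
        coefficient_field \<gamma> t\<^sub>0 K \<and> diff_hom fls_deriv K \<delta> \<iota> \<and>
        A = (\<chi> i j. \<iota> (variational_matrix (quad_field (of_real a)) \<gamma> t\<^sub>0 $ i $ j)) \<and>
        picard_vessiot \<delta> (\<iota> ` K) L A 0 \<and> fundamental_matrix \<delta> L A F \<longrightarrow>
        comm_group (DGal_identity_component \<delta> (\<iota> ` K) L F))"
proof (intro conjI allI impI; (elim conjE)?)
  show "first_integral (quad_field a) (\<lambda>(x, y). y - a * x\<^sup>2)"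
    "first_integral (quad_field (complex_of_real a)) (\<lambda>(x, y). y - of_real a * x\<^sup>2)"
    by (rule first_integral_quad_field)+
next
  fix k\<^sub>1 k\<^sub>2 r s assume "compatible_roots a k\<^sub>1 r s"
  then show "integral_curve (quad_field (complex_of_real a)) {t. cos (s * (k\<^sub>2 + t)) \<noteq> 0} (tan_curve r s k\<^sub>2)"
    using a by (rule integral_curve_tan_curve)
next
  fix k\<^sub>1 k\<^sub>2 r s t assume "compatible_roots a k\<^sub>1 r s" "cos (s * (k\<^sub>2 + t)) \<noteq> 0"
  then show "deriv (tan_solution r s k\<^sub>2) t = of_real a * (tan_solution r s k\<^sub>2 t)\<^sup>2 + k\<^sub>1"
    using a by (intro DERIV_imp_deriv tan_solution_derivative)
next
  fix T t\<^sub>1 k\<^sub>1 r s and \<gamma> :: "complex \<Rightarrow> complex \<times> complex"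
  assume "integral_curve (quad_field (complex_of_real a)) T \<gamma>" "connected T" "t\<^sub>1 \<in> T" "snd (\<gamma> t\<^sub>1) \<noteq> 0"
    "k\<^sub>1 = snd (\<gamma> t\<^sub>1) - of_real a * (fst (\<gamma> t\<^sub>1))\<^sup>2" "k\<^sub>1 \<noteq> 0" "compatible_roots a k\<^sub>1 r s"
  then show "\<exists>k\<^sub>2. \<forall>t\<in>T. cos (s * (k\<^sub>2 + t)) \<noteq> 0 \<and> \<gamma> t = tan_curve r s k\<^sub>2 t"
    using a by (rule complex_integral_curve_eq_tan)
next
  fix T t\<^sub>1 k\<^sub>1 r s and \<gamma> :: "real \<Rightarrow> real \<times> real"
  assume "integral_curve (quad_field a) T \<gamma>" "connected T" "t\<^sub>1 \<in> T" "snd (\<gamma> t\<^sub>1) \<noteq> 0"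
    "k\<^sub>1 = snd (\<gamma> t\<^sub>1) - a * (fst (\<gamma> t\<^sub>1))\<^sup>2" "k\<^sub>1 \<noteq> 0" "compatible_roots a (of_real k\<^sub>1) r s"
  then show "\<exists>k\<^sub>2. \<forall>t\<in>T. cos (s * (k\<^sub>2 + of_real t)) \<noteq> 0 \<and>
      (complex_of_real (fst (\<gamma> t)), complex_of_real (snd (\<gamma> t))) = tan_curve r s k\<^sub>2 (of_real t)"
    using a by (rule real_integral_curve_eq_tan)
next
  show "foliation_slope (quad_field (complex_of_real a)) [:0, 2 * of_real a:]"
    by (rule foliation_slope_quad_field)
next
  fix \<delta> :: "'u \<Rightarrow> 'u" and \<iota> L
  assume "diff_hom rat_deriv UNIV \<delta> \<iota>"
    "picard_vessiot \<delta> (range \<iota>) L (0 :: 'u^1^1) (\<chi> i. \<iota> (to_fract [:0, 2 * complex_of_real a:]))"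
  then show "DGal \<delta> (range \<iota>) L \<cong> singleton_group ()" by (rule foliation_DGal)
next
  fix T \<gamma> t\<^sub>0 K and \<delta> :: "'v \<Rightarrow> 'v" and \<iota> L A F
  assume "integral_curve (quad_field (complex_of_real a)) T \<gamma>" "t\<^sub>0 \<in> T"
    "coefficient_field \<gamma> t\<^sub>0 K" "diff_hom fls_deriv K \<delta> \<iota>"
    "A = (\<chi> i j. \<iota> (variational_matrix (quad_field (of_real a)) \<gamma> t\<^sub>0 $ i $ j))"
    "picard_vessiot \<delta> (\<iota> ` K) L A 0" "fundamental_matrix \<delta> L A F"
  then show "comm_group (DGal_identity_component \<delta> (\<iota> ` K) L F)"
    using a by (intro variational_identity_component) simp_all
qed

end
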